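(* Let $\xi:[0,1]\to\mathbb{R}$ be a smooth strictly monotone function with $\int_0^1\xi(y)\,dy=0$, and let $C>0$. Then for all sufficiently small $r_0>0$ the following holds for every $\hat G\in\hat{\mathcal S}_{r_0}$. Assume that $L_0=0$ and $L_1>0$. Let $U=[\epsilon,1]\subset(0,1]$ with $\epsilon>0$ small, and let $x\in(0,1)$. Then for Lebesgue almost all $y\in[0,1]$, the number of $i\ge0$ with $\hat g^i_y(x)\in U$ is infinite, but $$\lim_{n\to\infty}\frac1n\sum_{i=0}^{n-1}\mathbf 1_U(\hat g^i_y(x))=0,$$ where $\mathbf 1_U$ is the characteristic function of $U$.
   Context: $E_2:[0,1]\to[0,1]$ is the doubling map $E_2(y)=2y-\lfloor 2y\rfloor$. For fixed $\xi$ and $C>0$, and for $r_0>0$, $\hat{\mathcal S}_{r_0}$ is the set of skew product maps $\hat G:[0,1]\times[0,1]\to[0,1]\times[0,1]$, $\hat G(y,x)=(E_2(y),\hat g_y(x))$, where $(y,x)\mapsto\hat g_y(x)$ is smooth, each $\hat g_y:[0,1]\to[0,1]$ is strictly increasing, and $$\hat g_y(x)=\frac{e^{\xi(y)}x}{1+(e^{\xi(y)}-1)x}+r(y,x)$$ with $|r(y,x)|\le Cx^2$, $|r(y,x)|\le C|1-x|$, and $|r(y,x)|,|\partial_x r(y,x)|,|\partial_y r(y,x)|\le r_0$ for all $(y,x)$. (In particular $\hat g_y(0)=0$, $\hat g_y(1)=1$.) Iterates: $\hat g^n_y=\hat g_{E_2^{n-1}(y)}\circ\cdots\circ\hat g_y$,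 with $\hat g^0_y=\mathrm{id}$. The fiber Lyapunov exponents are $L_0=\int_0^1\ln\hat g_y'(0)\,dy$ (which equals $\int_0^1\xi(y)\,dy=0$) and $L_1=\int_0^1\ln\hat g_y'(1)\,dy$, where $'$ denotes the derivative in $x$. *)

theory Defs
  imports "HOL-Analysis.Analysis"
begin

text \<open>
  \<open>C_k_on k S f\<close> says that \<open>f\<close> is \<open>k\<close> times continuously differentiable on \<open>S\<close>, with derivatives
  taken relative to \<open>S\<close> (one-sided at boundary points). It is meant for sets such as a
  nondegenerate compact interval or the unit square, where the derivative relative to \<open>S\<close> is
  unique. In finite dimension, requiring \<open>C_k_on k\<close> of each directional derivative is
  the same as requiring it of the full derivative.
\<close>

primrec C_k_on ::
  "nat \<Rightarrow> 'a::euclidean_space set \<Rightarrow> ('a \<Rightarrow> 'b::real_normed_vector) \<Rightarrow> bool" where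
  "C_k_on 0 S f \<longleftrightarrow> continuous_on S f"
| "C_k_on (Suc k) S f \<longleftrightarrow>
     (\<exists>f'. (\<forall>x\<in>S. (f has_derivative f' x) (at x within S)) \<and>
           (\<forall>v. C_k_on k S (\<lambda>x. f' x v)))"

definition smooth_on :: "'a::euclidean_space set \<Rightarrow> ('a \<Rightarrow> 'b::real_normed_vector) \<Rightarrow> bool" where
  "smooth_on S f \<longleftrightarrow> (\<forall>k. C_k_on k S f)"

definition E2 :: "real \<Rightarrow> real" where
  "E2 y = 2 * y - of_int \<lfloor>2 * y\<rfloor>"

definition fiber_map :: "(real \<times> real \<Rightarrow> real \<times> real) \<Rightarrow> real \<Rightarrow> real \<Rightarrow> real" where
  "fiber_map G y x = snd (G (y, x))"

text \<open>
  Maps of the unit square are total functions on \<open>real \<times> real\<close> of which only the values on the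
  square matter.
\<close>

definition skew_product_maps ::
  "(real \<Rightarrow> real) \<Rightarrow> real \<Rightarrow> real \<Rightarrow> (real \<times> real \<Rightarrow> real \<times> real) set" where
  "skew_product_maps \<xi> C r0 =
    {G. (\<forall>y\<in>{0..1}. \<forall>x\<in>{0..1}. G (y, x) = (E2 y, fiber_map G y x) \<and> fiber_map G y x \<in> {0..1}) \<and>
        smooth_on ({0..1} \<times> {0..1}) (\<lambda>(y, x). fiber_map G y x) \<and>
        (\<forall>y\<in>{0..1}. strict_mono_on {0..1} (fiber_map G y)) \<and>
        (\<exists>r :: real \<Rightarrow> real \<Rightarrow> real. \<forall>y\<in>{0..1}. \<forall>x\<in>{0..1}.
           fiber_map G y x = exp (\<xi> y) * x / (1 + (exp (\<xi> y) - 1) * x) + r y x \<and>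
           \<bar>r y x\<bar> \<le> C * x\<^sup>2 \<and> \<bar>r y x\<bar> \<le> C * \<bar>1 - x\<bar> \<and> \<bar>r y x\<bar> \<le> r0 \<and>
           (\<exists>rx. ((\<lambda>t. r y t) has_real_derivative rx) (at x within {0..1}) \<and> \<bar>rx\<bar> \<le> r0) \<and>
           (\<exists>ry. ((\<lambda>t. r t x) has_real_derivative ry) (at y within {0..1}) \<and> \<bar>ry\<bar> \<le> r0))}"

primrec fiber_iterate ::
  "(real \<times> real \<Rightarrow> real \<times> real) \<Rightarrow> nat \<Rightarrow> real \<Rightarrow> real \<Rightarrow> real" where
  "fiber_iterate G 0 y x = x"
| "fiber_iterate G (Suc n) y x = fiber_map G ((E2 ^^ n) y) (fiber_iterate G n y x)"

text \<open>
  The fiber Lyapunov exponents are \<open>fiber_lyapunov G 0\<close> and \<open>fiber_lyapunov G 1\<close>; there the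
  derivative of the fiber map is one-sided.
\<close>

definition fiber_lyapunov :: "(real \<times> real \<Rightarrow> real \<times> real) \<Rightarrow> real \<Rightarrow> real" where
  "fiber_lyapunov G x =
    integral {0..1} (\<lambda>y. ln (vector_derivative (fiber_map G y) (at x within {0..1})))"

end

(*
  In the coordinate u = logit x the fiber maps become f(y, u) = u + xi(y) + h(y, u) with h small
  when r0 is small, h = O(e^u) near u = -oo, and f(y, u) = u - ln g_y'(1) + o(1) near u = +oo.
  For small r0 the maps u -> f(y, u) have Lipschitz constant 3/2, less than the expansion 2 of the
  base, so u_n(y) oscillates by at most a constant D over a dyadic interval of length 2^-n. Its
  averages Z_n over these intervals form a process adapted to the dyadic filtration with |Z_n - u_n| <= D, bounded steps,
  drift O(e^Z) at -oo (xi has mean zero and E_2^n y is equidistributed on the interval), drift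
  close to -L_1 < 0 at +oo, and, after passing to blocks of m steps, a probability at least 2^-m
  of going down by 1, because xi < 0 at one of the two fixed points 0 and 1 of the branches of E_2.

  Recurrence: sqrt(-Z) has strictly negative drift below some level -R, so Z cannot stay below -R:
  the expected total loss is finite, which forces Z -> -oo on the event of staying below, while
  sqrt(-Z) stays bounded in mean.

  Zero frequency: a concave function q with q'(z) = exp(-a e^min(z,M)) has drift <= 0 everywhere
  and <= -c on {Z >= -R}. Flattening q below by a convex (Huber) cutoff of width A makes it bounded
  below and costs a drift of at most K^2/(2A); an exponential Chebyshev bound and Borel-Cantelli
  show that the frequency of {Z >= -R} is O(1/A) for every A.
*)

theory Submission
  imports Defs
begin

section \<open>Random walks on regular trees\<close>

text \<open>Heuristically Z is a centered walk at the bottom, pushed down at the top, hence null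
  recurrent; the two assertions express this. The obstacle is that the orbit at time n depends on
  all binary digits of y and not only on the first n, so it is not adapted. The averages depend on n
  digits only, and their drift is the integral of \<xi>, which is 0, up to O(e^Z). A merely small
  constant error would not do: the strict concavity of sqrt gains only an amount of order
  |Z|^(-3/2), which dominates an exponentially small error. No variance estimate is needed, since
  one child that descends by 1 already makes Jensen's inequality strict. No probability space is set
  up either: node j < B^n of level n in a B-ary tree stands for the interval [j / B^n, (j + 1) /
  B^n), expectations are sums over a level, and conditional expectations are sums over the B
  children of a node.\<close>

lemma sum_power_Suc_group:
  fixes g :: "nat \<Rightarrow> 'a::comm_monoid_add"
  shows "(\<Sum>j<B ^ Suc n. g j) = (\<Sum>j<B ^ n. \<Sum>i<B. g (B * j + i))"
proof -
  have "(\<Sum>i<B. g (B * j + i)) = sum g {j * B..<j * B + B}" for j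
    using sum.shift_bounds_nat_ivl[of g 0 "j * B" B]
    by (simp add: atLeast0LessThan mult.commute add.commute)
  then have "(\<Sum>j<B ^ n. \<Sum>i<B. g (B * j + i)) = (\<Sum>j<B ^ n. sum g {j * B..<j * B + B})"
    by simp
  also have "\<dots> = sum g {..<B ^ n * B}" by (rule sum.nat_group)
  finally show ?thesis by (simp add: mult.commute)
qed

lemma tree_supermartingale_sum_le:
  fixes \<Phi> :: "nat \<Rightarrow> nat \<Rightarrow> real"
  assumes "\<And>n j. (\<Sum>i<B. \<Phi> (Suc n) (B * j + i)) \<le> real B * \<Phi> n j"
  shows "(\<Sum>j<B ^ n. \<Phi> n j) \<le> real B ^ n * \<Phi> 0 0"
proof (induction n)
  case (Suc n)
  have "(\<Sum>j<B ^ Suc n. \<Phi> (Suc n) j) = (\<Sum>j<B ^ n. \<Sum>i<B. \<Phi> (Suc n) (B * j + i))"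
    by (rule sum_power_Suc_group)
  also have "\<dots> \<le> (\<Sum>j<B ^ n. real B * \<Phi> n j)" by (intro sum_mono assms)
  also have "\<dots> = real B * (\<Sum>j<B ^ n. \<Phi> n j)" by (simp add: sum_distrib_left)
  also have "\<dots> \<le> real B * (real B ^ n * \<Phi> 0 0)" by (intro mult_left_mono Suc) simp
  finally show ?case by (simp add: mult.assoc)
qed simp

section \<open>Scalar estimates for the exponential and the Huber cutoff\<close>

lemma exp_le_quadratic:
  fixes s :: real
  assumes "\<bar>s\<bar> \<le> 1"
  shows "exp s \<le> 1 + s + s\<^sup>2"
proof (cases "s \<ge> 0")
  case True
  then show ?thesis using exp_bound[of s] assms by simp
next
  case False
  have "(1 + s + s\<^sup>2) * (1 - s) = 1 - s ^ 3" by (simp add: algebra_simps power2_eq_square power3_eq_cube)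
  also have "\<dots> \<ge> 1" using False by (simp add: power_le_zero_eq)
  finally have *: "1 \<le> (1 + s + s\<^sup>2) * (1 - s)" .
  have "1 - s \<le> exp (- s)" using exp_ge_add_one_self[of "- s"] by simp
  then have "exp s \<le> 1 / (1 - s)" using False by (simp add: exp_minus field_simps)
  also have "\<dots> \<le> 1 + s + s\<^sup>2" using * False by (simp add: field_simps)
  finally show ?thesis .
qed

definition huber :: "real \<Rightarrow> real \<Rightarrow> real" where
  "huber A w = (if w \<le> 0 then 0 else if w \<le> A then w\<^sup>2 / (2 * A) else w - A / 2)"

definition huber_deriv :: "real \<Rightarrow> real \<Rightarrow> real" where
  "huber_deriv A w = max 0 (min 1 (w / A))"

lemma huber_nonneg: "A > 0 \<Longrightarrow> huber A w \<ge> 0"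
  by (auto simp: huber_def)

text \<open>The slope \<open>huber_deriv A\<close> is Lipschitz with constant 1 / A, so this is
  Taylor's bound with curvature at most 1 / A. The cases follow the branch of \<open>huber\<close>
  that contains the base point w.\<close>

lemma huber_upper:
  assumes A: "A > 0"
  shows "huber A (w + d) \<le> huber A w + huber_deriv A w * d + d\<^sup>2 / (2 * A)"
proof -
  have 1: "huber A x \<le> x\<^sup>2 / (2 * A)" for x
  proof -
    have "0 \<le> (x - A)\<^sup>2" by simp
    then have "x - A / 2 \<le> x\<^sup>2 / (2 * A)" using A by (simp add: power2_eq_square field_simps)
    then show ?thesis using A by (auto simp: huber_def)
  qed
  consider "w \<le> 0" | "0 < w" "w \<le> A" | "w > A" by linarith
  then show ?thesis
  proof cases
    case 1
    have "huber A (w + d) \<le> d\<^sup>2 / (2 * A)"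
    proof (cases "w + d \<le> 0")
      case True
      then show ?thesis using A by (simp add: huber_def)
    next
      case False
      then have "(w + d)\<^sup>2 \<le> d\<^sup>2" using 1 by (intro power_mono) auto
      then have "(w + d)\<^sup>2 / (2 * A) \<le> d\<^sup>2 / (2 * A)" using A by (simp add: divide_right_mono)
      then show ?thesis using \<open>\<And>x. huber A x \<le> x\<^sup>2 / (2 * A)\<close>[of "w + d"] by linarith
    qed
    moreover have "huber_deriv A w = 0" using 1 A divide_nonpos_pos[of w A] by (simp add: huber_deriv_def)
    ultimately show ?thesis using 1 by (simp add: huber_def)
  next
    case 2
    have "huber_deriv A w = w / A" using 2 A by (simp add: huber_deriv_def max_def min_def field_simps)
    moreover have "(w + d)\<^sup>2 / (2 * A) = w\<^sup>2 / (2 * A) + w / A * d + d\<^sup>2 / (2 * A)"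
      using A by (simp add: field_simps power2_eq_square)
    ultimately show ?thesis using 2 \<open>\<And>x. huber A x \<le> x\<^sup>2 / (2 * A)\<close>[of "w + d"] by (simp add: huber_def)
  next
    case 3
    have d: "huber_deriv A w = 1" using 3 A by (simp add: huber_deriv_def)
    have h: "huber A w = w - A / 2" using 3 A by (simp add: huber_def)
    have "huber A (w + d) \<le> w - A / 2 + d + d\<^sup>2 / (2 * A)"
    proof -
      consider "w + d > A" | "0 < w + d" "w + d \<le> A" | "w + d \<le> 0" by linarith
      then show ?thesis
      proof cases
        case 1
        then show ?thesis using A by (simp add: huber_def)
      next
        case 2
        have "(A - (w + d))\<^sup>2 \<le> (- d)\<^sup>2" using 2 3 by (intro power_mono) auto
        then have "0 \<le> (d\<^sup>2 - (A - (w + d))\<^sup>2) / (2 * A)" using A by simp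
        also have "\<dots> = w - A / 2 + d + d\<^sup>2 / (2 * A) - (w + d)\<^sup>2 / (2 * A)"
          using A by (simp add: field_simps power2_eq_square)
        finally have "(w + d)\<^sup>2 / (2 * A) \<le> w - A / 2 + d + d\<^sup>2 / (2 * A)" by simp
        then show ?thesis using 2 by (simp add: huber_def)
      next
        case c: 3
        have "(A - (w + d))\<^sup>2 \<le> (- d)\<^sup>2" using c 3 A by (intro power_mono) auto
        moreover have "0 \<le> (w + d)\<^sup>2" by simp
        ultimately have "A * A - 2 * A * (w + d) \<le> d * d"
          by (simp add: power2_eq_square algebra_simps)
        then have "0 \<le> w - A / 2 + d + d\<^sup>2 / (2 * A)"
          using A by (simp add: field_simps power2_eq_square)
        then show ?thesis using c by (simp add: huber_def)
      qed
    qed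
    then show ?thesis using d h by simp
  qed
qed

text \<open>A martingale up to O(e^Z) at the bottom and a strict supermartingale above M. In between
  only a bounded drift and \<open>down\<close> are available, so a test function must be strongly
  concave there.\<close>

locale tree_walk =
  fixes B :: nat and Z :: "nat \<Rightarrow> nat \<Rightarrow> real" and K M L :: real
  assumes B_pos: "B > 0" and K_pos: "K > 0" and L_pos: "L > 0"
    and step: "i < B \<Longrightarrow> \<bar>Z (Suc n) (B * j + i) - Z n j\<bar> \<le> K"
    and drift_low: "\<bar>(\<Sum>i<B. Z (Suc n) (B * j + i)) - B * Z n j\<bar> \<le> B * (K * exp (Z n j))"
    and drift_high: "Z n j \<ge> M \<Longrightarrow> (\<Sum>i<B. Z (Suc n) (B * j + i)) \<le> B * (Z n j - L)"
    and down: "\<exists>i<B. Z (Suc n) (B * j + i) \<le> Z n j - 1"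
begin

lemma sum_le_with_gain:
  fixes F b :: "nat \<Rightarrow> real"
  assumes "\<And>i. i < B \<Longrightarrow> F i \<le> b i" "k < B" "F k \<le> b k - g"
  shows "(\<Sum>i<B. F i) \<le> (\<Sum>i<B. b i) - g"
proof -
  have "(\<Sum>i<B. F i) \<le> (\<Sum>i<B. b i - (if i = k then g else 0))"
    using assms by (intro sum_mono) auto
  also have "\<dots> = (\<Sum>i<B. b i) - g" using assms(2) by (simp add: sum_subtractf)
  finally show ?thesis .
qed

text \<open>Tangent lines bound a concave q from above, so the drift error costs at most s K e^Z per
  child, where s is the slope at Z. The child given by \<open>down\<close> lies at least 1 lower,
  where concavity gains s a e^Z / e. The factor B (K + 1) in a lets this single gain pay for all B
  children and leave s e^Z for each. Above M the slope is constant and \<open>drift_high\<close>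
  applies directly.\<close>

lemma drift_function:
  obtains q :: "real \<Rightarrow> real" where
    "mono q" "\<And>x y. \<bar>q x - q y\<bar> \<le> \<bar>x - y\<bar>"
    "\<And>n j. (\<Sum>i<B. q (Z (Suc n) (B * j + i))) \<le> B * q (Z n j)"
    "\<And>R. \<exists>c>0. \<forall>n j. Z n j \<ge> - R \<longrightarrow> (\<Sum>i<B. q (Z (Suc n) (B * j + i))) \<le> B * (q (Z n j) - c)"
proof -
  define a where "a = exp 1 * B * (K + 1)"
  have a: "a > 0" using B_pos K_pos by (simp add: a_def)
  define s where "s z = exp (- a * exp (min z M))" for z :: real
  have s_pos: "s z > 0" and s_le: "s z \<le> 1" for z using a by (auto simp: s_def)
  have s_anti: "s z \<le> s y" if "y \<le> z" for y z
    using that a by (auto simp: s_def min_def)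
  have "\<exists>q. \<forall>x::real. -\<infinity> < ereal x \<longrightarrow> ereal x < \<infinity> \<longrightarrow> (q has_vector_derivative s x) (at x)"
    by (rule einterval_antiderivative) (auto simp: s_def intro!: continuous_intros)
  then obtain q where q: "\<And>x. (q has_real_derivative s x) (at x)"
    by (auto simp: has_real_derivative_iff_has_vector_derivative)
  have mvt: "\<exists>z. x < z \<and> z < y \<and> q y - q x = (y - x) * s z" if "x < y" for x y
    using MVT2[of x y q s] that q by auto
  have mono: "mono q"
  proof (rule monoI)
    fix x y :: real assume "x \<le> y"
    then show "q x \<le> q y"
    proof (cases "x = y")
      case False
      then obtain z where "q y - q x = (y - x) * s z" using mvt[of x y] \<open>x \<le> y\<close> by auto
      then show ?thesis using \<open>x \<le> y\<close> s_pos[of z] by (smt (verit) mult_nonneg_nonneg)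
    qed simp
  qed
  have lip': "\<bar>q x - q y\<bar> \<le> \<bar>x - y\<bar>" if lt: "x < y" for x y
  proof -
    obtain z where "q y - q x = (y - x) * s z" using mvt[OF lt] by auto
    moreover have "(y - x) * s z \<le> (y - x) * 1" by (intro mult_left_mono s_le) (use lt in auto)
    moreover have "(y - x) * s z \<ge> 0" using s_pos[of z] lt by simp
    ultimately show ?thesis using lt by simp
  qed
  have lip: "\<bar>q x - q y\<bar> \<le> \<bar>x - y\<bar>" for x y
    using lip'[of x y] lip'[of y x] by (cases x y rule: linorder_cases) auto
  have q1: "q y \<le> q z + s z * (y - z)" for y z
  proof (cases y z rule: linorder_cases)
    case less
    then obtain t where t: "y < t" "t < z" "q z - q y = (z - y) * s t" using mvt by blast
    have "(z - y) * s t \<ge> (z - y) * s z" by (intro mult_left_mono s_anti) (use t less in auto)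
    then show ?thesis using t by (simp add: algebra_simps)
  next
    case greater
    then obtain t where t: "z < t" "t < y" "q y - q z = (y - z) * s t" using mvt by blast
    have "(y - z) * s t \<le> (y - z) * s z" by (intro mult_left_mono s_anti) (use t greater in auto)
    then show ?thesis using t by (simp add: algebra_simps)
  qed simp
  \<comment> \<open>Integrating s t / s z = exp (a (e^z - e^t)) \<ge> 1 + a (e^z - e^t) from y to z
    improves the tangent bound by s z * a e^z (e^d - 1 - d) with d = y - z. For d \<le> -1 the last
    factor is at least 1 / e, its value at d = -1. Monotonicity of F carries out the
    integration.\<close>
  have q2: "q y \<le> q z + s z * (y - z) - s z * (a * exp z / exp 1)" if zM: "z \<le> M" and yz: "y \<le> z - 1" for y z
  proof -
    define d where "d = y - z"
    have d: "d \<le> -1" using yz by (simp add: d_def)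
    define F where "F t = q t - s z * ((1 + a * exp z) * t - a * exp t)" for t
    have "\<exists>D. DERIV F t :> D \<and> 0 \<le> D" if "t \<le> z" for t
    proof (intro exI conjI)
      show "DERIV F t :> s t - s z * ((1 + a * exp z) - a * exp t)"
        unfolding F_def by (auto intro!: derivative_eq_intros q)
      have "s t = s z * exp (a * (exp z - exp t))"
        using that zM by (simp add: s_def min_def exp_add[symmetric] algebra_simps)
      moreover have "exp (a * (exp z - exp t)) \<ge> 1 + a * (exp z - exp t)" by (rule exp_ge_add_one_self)
      then have "s z * exp (a * (exp z - exp t)) \<ge> s z * (1 + a * (exp z - exp t))"
        using s_pos[of z] by (intro mult_left_mono) auto
      ultimately show "0 \<le> s t - s z * ((1 + a * exp z) - a * exp t)"
        by (simp add: algebra_simps)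
    qed
    then have "F y \<le> F z" using yz DERIV_nonneg_imp_nondecreasing[of y z F] by simp
    then have "q y \<le> q z + s z * (d - a * exp z * (exp d - 1 - d))"
    proof -
      have "y = z + d" by (simp add: d_def)
      then have "exp y = exp z * exp d" by (simp add: exp_add)
      with \<open>F y \<le> F z\<close> have "q y - s z * ((1 + a * exp z) * (z + d) - a * (exp z * exp d))
          \<le> q z - s z * ((1 + a * exp z) * z - a * exp z)"
        by (simp only: F_def \<open>y = z + d\<close>)
      then show ?thesis by (simp only: algebra_simps)
    qed
    moreover have "exp d - 1 - d \<ge> 1 / exp 1"
    proof -
      have "exp d = exp (d + 1) / exp 1" by (simp add: exp_add)
      moreover have "exp (d + 1) / exp 1 \<ge> (1 + (d + 1)) / exp 1"
        using exp_ge_add_one_self[of "d + 1"] by (intro divide_right_mono) auto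
      moreover have "(1 + (d + 1)) / exp 1 = 1 / exp 1 + (d + 1) / exp 1" by (simp add: add_divide_distrib)
      moreover have "(d + 1) / exp 1 \<ge> (d + 1)"
      proof -
        have "(d + 1) * exp 1 \<le> (d + 1) * 1" using d by (intro mult_left_mono_neg) auto
        then show ?thesis by (simp add: field_simps)
      qed
      ultimately show ?thesis by linarith
    qed
    then have "s z * (a * exp z * (exp d - 1 - d)) \<ge> s z * (a * exp z * (1 / exp 1))"
      using s_pos[of z] a by (intro mult_left_mono) auto
    ultimately show ?thesis by (simp add: d_def algebra_simps)
  qed
  have sum_tangent: "(\<Sum>i<B. q (Z n j) + s (Z n j) * (Z (Suc n) (B * j + i) - Z n j))
      = B * q (Z n j) + s (Z n j) * ((\<Sum>i<B. Z (Suc n) (B * j + i)) - B * Z n j)" for n j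
    by (simp add: sum.distrib sum_distrib_left[symmetric] sum_subtractf)
  have low: "(\<Sum>i<B. q (Z (Suc n) (B * j + i))) \<le> B * (q (Z n j) - s (Z n j) * exp (Z n j))"
    if "Z n j \<le> M" for n j
  proof -
    obtain k where k: "k < B" "Z (Suc n) (B * j + k) \<le> Z n j - 1" using down by blast
    have "(\<Sum>i<B. q (Z (Suc n) (B * j + i))) \<le>
      (\<Sum>i<B. q (Z n j) + s (Z n j) * (Z (Suc n) (B * j + i) - Z n j)) - s (Z n j) * (a * exp (Z n j) / exp 1)"
      by (rule sum_le_with_gain[of _ _ k]) (use q1 q2[OF that k(2)] k in auto)
    also have "\<dots> \<le> B * q (Z n j) + s (Z n j) * (B * (K * exp (Z n j))) - s (Z n j) * (a * exp (Z n j) / exp 1)"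
      unfolding sum_tangent using drift_low[of n j] s_pos[of "Z n j"]
      by (intro diff_right_mono add_left_mono mult_left_mono) auto
    also have "a * exp (Z n j) / exp 1 = B * (K + 1) * exp (Z n j)" by (simp add: a_def)
    also have "B * q (Z n j) + s (Z n j) * (B * (K * exp (Z n j))) - s (Z n j) * (B * (K + 1) * exp (Z n j))
        = B * (q (Z n j) - s (Z n j) * exp (Z n j))"
      by (simp add: algebra_simps)
    finally show ?thesis .
  qed
  have high: "(\<Sum>i<B. q (Z (Suc n) (B * j + i))) \<le> B * (q (Z n j) - s M * L)"
    if "Z n j \<ge> M" for n j
  proof -
    have "(\<Sum>i<B. q (Z (Suc n) (B * j + i))) \<le>
      (\<Sum>i<B. q (Z n j) + s (Z n j) * (Z (Suc n) (B * j + i) - Z n j))"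
      by (intro sum_mono q1)
    also have "\<dots> \<le> B * q (Z n j) + s (Z n j) * (- B * L)"
      unfolding sum_tangent using drift_high[OF that] s_pos[of "Z n j"]
      by (intro add_left_mono mult_left_mono) (auto simp: algebra_simps)
    also have "s (Z n j) = s M" using that by (simp add: s_def)
    finally show ?thesis by (simp add: algebra_simps)
  qed
  show thesis
  proof (rule that[of q])
    fix n j
    show "(\<Sum>i<B. q (Z (Suc n) (B * j + i))) \<le> B * q (Z n j)"
    proof (cases "Z n j \<le> M")
      case True
      have "B * (q (Z n j) - s (Z n j) * exp (Z n j)) \<le> B * q (Z n j)"
        using s_pos[of "Z n j"] by (intro mult_left_mono) auto
      then show ?thesis using low[OF True] by linarith
    next
      case False
      have "B * (q (Z n j) - s M * L) \<le> B * q (Z n j)"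
        using s_pos[of M] L_pos by (intro mult_left_mono) auto
      then show ?thesis using high[of n j] False by linarith
    qed
  next
    fix R :: real
    define c where "c = s M * min L (exp (- R))"
    have "(\<Sum>i<B. q (Z (Suc n) (B * j + i))) \<le> B * (q (Z n j) - c)" if "Z n j \<ge> - R" for n j
    proof (cases "Z n j \<le> M")
      case True
      have "s M * min L (exp (- R)) \<le> s (Z n j) * exp (Z n j)"
        using that True s_pos[of M] s_pos[of "Z n j"] L_pos by (intro mult_mono s_anti) (auto simp: min_le_iff_disj)
      then have "B * (q (Z n j) - s (Z n j) * exp (Z n j)) \<le> B * (q (Z n j) - c)"
        unfolding c_def by (intro mult_left_mono) auto
      then show ?thesis using low[OF True] by linarith
    next
      case False
      have "s M * min L (exp (- R)) \<le> s M * L"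
        using s_pos[of M] by (intro mult_left_mono) auto
      then have "B * (q (Z n j) - s M * L) \<le> B * (q (Z n j) - c)"
        unfolding c_def by (intro mult_left_mono) auto
      then show ?thesis using high[of n j] False by linarith
    qed
    moreover have "c > 0" using s_pos L_pos by (simp add: c_def)
    ultimately show "\<exists>c>0. \<forall>n j. Z n j \<ge> - R \<longrightarrow> (\<Sum>i<B. q (Z (Suc n) (B * j + i))) \<le> B * (q (Z n j) - c)"
      by blast
  qed (use mono lip in auto)
qed

text \<open>\<open>j div B ^ (n - k)\<close> is the ancestor of j at level k. Level n itself is left
  out, so passing to a child adds the indicator at the parent.\<close>

definition visits :: "real \<Rightarrow> nat \<Rightarrow> nat \<Rightarrow> real" where
  "visits R n j = (\<Sum>k<n. of_bool (Z k (j div B ^ (n - k)) \<ge> - R))"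

lemma visits_child:
  assumes "i < B"
  shows "visits R (Suc n) (B * j + i) = visits R n j + of_bool (Z n j \<ge> - R)"
proof -
  have "(B * j + i) div B ^ (Suc n - k) = j div B ^ (n - k)" if "k \<le> n" for k
    using that assms by (simp add: Suc_diff_le div_mult2_eq)
  then show ?thesis by (simp add: visits_def)
qed

text \<open>A is chosen so that flattening q costs at most c \<eta> / 4 per step. The drift -c of
  \<psi> on {Z \<ge> -R} cancels the growth of c * \<open>visits\<close>. Subtracting c \<eta> / 2
  per step leaves increments Y of mean at most -c \<eta> / 4, which pays for the quadratic term of
  the exponential, so \<Phi> is a supermartingale. Since \<psi> \<ge> 0, \<Phi> is exponentially
  large wherever there are at least \<eta> n visits.\<close>

lemma visits_large_deviation:
  assumes \<eta>: "\<eta> > 0"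
  obtains c \<theta> :: real where "\<theta> > 0" "\<theta> < 1"
    "\<And>n. card {j. j < B ^ n \<and> visits R n j \<ge> \<eta> * n} \<le> c * \<theta> ^ n * B ^ n"
proof -
  obtain q :: "real \<Rightarrow> real" where q: "mono q" "\<And>x y. \<bar>q x - q y\<bar> \<le> \<bar>x - y\<bar>"
    "\<And>n j. (\<Sum>i<B. q (Z (Suc n) (B * j + i))) \<le> B * q (Z n j)"
    "\<And>R. \<exists>c>0. \<forall>n j. Z n j \<ge> - R \<longrightarrow> (\<Sum>i<B. q (Z (Suc n) (B * j + i))) \<le> B * (q (Z n j) - c)"
    by (rule drift_function) (rule that; assumption)
  obtain c where c: "c > 0"
    "\<And>n j. Z n j \<ge> - R \<Longrightarrow> (\<Sum>i<B. q (Z (Suc n) (B * j + i))) \<le> B * (q (Z n j) - c)"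
    using q(4)[of R] by blast
  define A where "A = 2 * K\<^sup>2 / (c * \<eta>)"
  have A: "A > 0" using K_pos c \<eta> by (simp add: A_def)
  have KA: "K\<^sup>2 / (2 * A) = c * \<eta> / 4" using K_pos c \<eta> by (simp add: A_def field_simps)
  \<comment> \<open>The shift gives v = A at z = -R, so \<open>huber_deriv A\<close> is 1 on all of
    {Z \<ge> -R} and none of the gain c is lost there.\<close>
  define v where "v z = q z - q (- R) + A" for z
  define \<psi> where "\<psi> z = huber A (v z)" for z
  have dv: "\<bar>v x - v y\<bar> \<le> \<bar>x - y\<bar>" for x y using q(2)[of x y] by (simp add: v_def)
  define D where "D n j i = v (Z (Suc n) (B * j + i)) - v (Z n j)" for n j i
  have D: "\<bar>D n j i\<bar> \<le> K" if "i < B" for n j i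
    using dv[of "Z (Suc n) (B * j + i)" "Z n j"] step[OF that, of n j] by (simp add: D_def)
  have hd: "0 \<le> huber_deriv A w" "huber_deriv A w \<le> 1" for w by (auto simp: huber_deriv_def)
  have psi_step: "\<psi> (Z (Suc n) (B * j + i)) - \<psi> (Z n j) \<le> huber_deriv A (v (Z n j)) * D n j i + c * \<eta> / 4"
    if "i < B" for n j i
  proof -
    have "\<psi> (Z (Suc n) (B * j + i)) \<le> \<psi> (Z n j) + huber_deriv A (v (Z n j)) * D n j i + (D n j i)\<^sup>2 / (2 * A)"
      using huber_upper[OF A, of "v (Z n j)" "D n j i"] by (simp add: \<psi>_def D_def)
    moreover have "(D n j i)\<^sup>2 / (2 * A) \<le> K\<^sup>2 / (2 * A)"
      using D[OF that, of n j] A by (intro divide_right_mono) (auto simp: abs_le_square_iff[symmetric])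
    ultimately show ?thesis using KA by linarith
  qed
  have sumD: "(\<Sum>i<B. D n j i) \<le> - B * c * of_bool (Z n j \<ge> - R)" for n j
  proof -
    have "(\<Sum>i<B. D n j i) = (\<Sum>i<B. q (Z (Suc n) (B * j + i))) - B * q (Z n j)"
      by (simp add: D_def v_def sum_subtractf)
    then show ?thesis using q(3)[where n = n and j = j] c(2)[of n j] by (auto simp: algebra_simps)
  qed
  have wsum: "(\<Sum>i<B. huber_deriv A (v (Z n j)) * D n j i) \<le> - B * c * of_bool (Z n j \<ge> - R)" for n j
  proof -
    have "(\<Sum>i<B. huber_deriv A (v (Z n j)) * D n j i) = huber_deriv A (v (Z n j)) * (\<Sum>i<B. D n j i)"
      by (simp add: sum_distrib_left)
    also have "\<dots> \<le> huber_deriv A (v (Z n j)) * (- B * c * of_bool (Z n j \<ge> - R))"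
      by (intro mult_left_mono sumD hd)
    also have "\<dots> = - B * c * of_bool (Z n j \<ge> - R)"
    proof (cases "Z n j \<ge> - R")
      case True
      then have "v (Z n j) \<ge> A" using monoD[OF q(1), of "- R" "Z n j"] by (simp add: v_def)
      then have "huber_deriv A (v (Z n j)) = 1" using A by (simp add: huber_deriv_def)
      then show ?thesis by simp
    qed simp
    finally show ?thesis .
  qed
  define Y where "Y n j i = huber_deriv A (v (Z n j)) * D n j i + c * of_bool (Z n j \<ge> - R) - c * \<eta> / 4" for n j i
  have Ysum: "(\<Sum>i<B. Y n j i) \<le> - (B * (c * \<eta> / 4))" for n j
    using wsum[of n j] by (simp add: Y_def sum.distrib sum_subtractf)
  define H where "H = K + c + c * \<eta> / 4"
  have H: "H > 0" using K_pos c \<eta> by (simp add: H_def add_pos_pos)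
  have YH: "\<bar>Y n j i\<bar> \<le> H" if "i < B" for n j i
  proof -
    have "\<bar>huber_deriv A (v (Z n j)) * D n j i\<bar> \<le> 1 * K"
      unfolding abs_mult using D[OF that, of n j] hd by (intro mult_mono) auto
    moreover have "c * \<eta> > 0" using c(1) \<eta> by simp
    moreover have "0 \<le> c * of_bool (Z n j \<ge> - R)" "c * of_bool (Z n j \<ge> - R) \<le> c"
      using c(1) by auto
    ultimately show ?thesis unfolding Y_def H_def by linarith
  qed
  \<comment> \<open>The first bound keeps |t Y| \<le> 1 for \<open>exp_le_quadratic\<close>; the
    second keeps t Y^2 below the mean gain c \<eta> / 4.\<close>
  define t where "t = min (1 / H) (c * \<eta> / (4 * H\<^sup>2))"
  have t: "t > 0" "t * H \<le> 1" "t * H\<^sup>2 \<le> c * \<eta> / 4"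
    using H c \<eta> by (auto simp: t_def field_simps min_def power2_eq_square)
  have expY: "(\<Sum>i<B. exp (t * Y n j i)) \<le> B" for n j
  proof -
    have "(\<Sum>i<B. exp (t * Y n j i)) \<le> (\<Sum>i<B. 1 + t * Y n j i + t * (c * \<eta> / 4))"
    proof (intro sum_mono)
      fix i assume "i \<in> {..<B}"
      then have Y: "\<bar>Y n j i\<bar> \<le> H" using YH by simp
      then have "\<bar>t * Y n j i\<bar> \<le> t * H" using t by (simp add: abs_mult)
      then have "exp (t * Y n j i) \<le> 1 + t * Y n j i + (t * Y n j i)\<^sup>2"
        using t by (intro exp_le_quadratic) auto
      also have "(t * Y n j i)\<^sup>2 \<le> t * (t * H\<^sup>2)"
      proof -
        have "(Y n j i)\<^sup>2 \<le> H\<^sup>2" using Y H by (simp add: abs_le_square_iff[symmetric])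
        then show ?thesis using t by (simp add: power_mult_distrib power2_eq_square[of t] mult.assoc)
      qed
      also have "t * (t * H\<^sup>2) \<le> t * (c * \<eta> / 4)" using t by (intro mult_left_mono) auto
      finally show "exp (t * Y n j i) \<le> 1 + t * Y n j i + t * (c * \<eta> / 4)" by simp
    qed
    also have "\<dots> = B + t * (\<Sum>i<B. Y n j i) + t * (B * (c * \<eta> / 4))"
      by (simp add: sum.distrib sum_distrib_left[symmetric] algebra_simps)
    also have "t * (\<Sum>i<B. Y n j i) \<le> t * (- (B * (c * \<eta> / 4)))"
      using t by (intro mult_left_mono Ysum) auto
    finally show ?thesis by simp
  qed
  define \<Phi> where "\<Phi> n j = exp (t * (\<psi> (Z n j) + c * visits R n j - n * (c * \<eta> / 2)))" for n j
  have Phi: "(\<Sum>i<B. \<Phi> (Suc n) (B * j + i)) \<le> real B * \<Phi> n j" for n j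
  proof -
    have "\<Phi> (Suc n) (B * j + i) \<le> \<Phi> n j * exp (t * Y n j i)" if "i < B" for i
    proof -
      have "\<psi> (Z (Suc n) (B * j + i)) + c * visits R (Suc n) (B * j + i) - Suc n * (c * \<eta> / 2)
        \<le> (\<psi> (Z n j) + c * visits R n j - n * (c * \<eta> / 2)) + Y n j i"
      proof -
        have "c * visits R (Suc n) (B * j + i) = c * visits R n j + c * of_bool (Z n j \<ge> - R)"
          by (simp only: visits_child[OF that] distrib_left)
        moreover have "Suc n * (c * \<eta> / 2) = n * (c * \<eta> / 2) + c * \<eta> / 2"
          by (simp add: distrib_right add_divide_distrib)
        ultimately show ?thesis
          using psi_step[OF that, of n j] unfolding Y_def by linarith
      qed
      then have "t * (\<psi> (Z (Suc n) (B * j + i)) + c * visits R (Suc n) (B * j + i) - Suc n * (c * \<eta> / 2))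
        \<le> t * ((\<psi> (Z n j) + c * visits R n j - n * (c * \<eta> / 2)) + Y n j i)"
        using t by (intro mult_left_mono) auto
      then show ?thesis by (simp add: \<Phi>_def exp_add[symmetric] distrib_left)
    qed
    then have "(\<Sum>i<B. \<Phi> (Suc n) (B * j + i)) \<le> (\<Sum>i<B. \<Phi> n j * exp (t * Y n j i))"
      by (intro sum_mono) auto
    also have "\<dots> = \<Phi> n j * (\<Sum>i<B. exp (t * Y n j i))" by (simp add: sum_distrib_left)
    also have "\<dots> \<le> \<Phi> n j * B" by (intro mult_left_mono expY) (simp add: \<Phi>_def)
    finally show ?thesis by (simp add: mult.commute)
  qed
  define \<theta> where "\<theta> = exp (- (t * (c * \<eta> / 2)))"
  show thesis
  proof (rule that[of \<theta> "\<Phi> 0 0"])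
    fix n
    let ?S = "{j. j < B ^ n \<and> visits R n j \<ge> \<eta> * n}"
    have "card ?S * exp (t * (n * (c * \<eta> / 2))) = (\<Sum>j\<in>?S. exp (t * (n * (c * \<eta> / 2))))" by simp
    also have "\<dots> \<le> (\<Sum>j\<in>?S. \<Phi> n j)"
    proof (intro sum_mono)
      fix j assume "j \<in> ?S"
      then have "c * visits R n j \<ge> c * (\<eta> * n)" using c by (intro mult_left_mono) auto
      moreover have "\<psi> (Z n j) \<ge> 0" using A by (simp add: \<psi>_def huber_nonneg)
      ultimately have "n * (c * \<eta> / 2) \<le> \<psi> (Z n j) + c * visits R n j - n * (c * \<eta> / 2)"
        by (simp add: algebra_simps)
      then show "exp (t * (n * (c * \<eta> / 2))) \<le> \<Phi> n j"
        unfolding \<Phi>_def exp_le_cancel_iff using t by (intro mult_left_mono) auto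
    qed
    also have "\<dots> \<le> (\<Sum>j<B ^ n. \<Phi> n j)" by (intro sum_mono2) (auto simp: \<Phi>_def)
    also have "\<dots> \<le> real B ^ n * \<Phi> 0 0" by (rule tree_supermartingale_sum_le) (rule Phi)
    finally have "card ?S * exp (t * (n * (c * \<eta> / 2))) * \<theta> ^ n \<le> real B ^ n * \<Phi> 0 0 * \<theta> ^ n"
      by (intro mult_right_mono) (auto simp: \<theta>_def)
    moreover have "exp (t * (n * (c * \<eta> / 2))) * \<theta> ^ n = 1"
      by (simp add: \<theta>_def exp_of_nat_mult[symmetric] exp_add[symmetric] algebra_simps)
    ultimately show "card ?S \<le> \<Phi> 0 0 * \<theta> ^ n * B ^ n"
      by (simp add: mult.assoc) (simp add: mult_ac)
  qed (use t c \<eta> in \<open>auto simp: \<theta>_def\<close>)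
qed

end

section \<open>The square-root test function and recurrence\<close>

lemma sqrt_add_eq:
  assumes "v > 0" "v + d \<ge> 0"
  shows "sqrt (v + d) = sqrt v + d / (2 * sqrt v) - (sqrt (v + d) - sqrt v)\<^sup>2 / (2 * sqrt v)"
proof -
  have "(sqrt (v + d) - sqrt v)\<^sup>2 = (v + d) + v - 2 * sqrt v * sqrt (v + d)"
    using assms by (simp add: power2_diff)
  then have "d - (sqrt (v + d) - sqrt v)\<^sup>2 = 2 * sqrt v * (sqrt (v + d) - sqrt v)"
    using assms by (simp add: algebra_simps)
  then have "(d - (sqrt (v + d) - sqrt v)\<^sup>2) / (2 * sqrt v) = sqrt (v + d) - sqrt v"
    using assms by simp
  then show ?thesis by (simp add: diff_divide_distrib)
qed

lemma sqrt_add_le: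
  assumes "v > 0" "v + d \<ge> 0"
  shows "sqrt (v + d) \<le> sqrt v + d / (2 * sqrt v)"
  using sqrt_add_eq[OF assms] assms by (smt (verit) divide_nonneg_nonneg real_sqrt_ge_zero zero_le_power2)

text \<open>The remainder in \<open>sqrt_add_eq\<close> grows with d, so for d \<ge> 1 it is at
  least its value at d = 1, where sqrt (v + 1) - sqrt v = 1 / (sqrt (v + 1) + sqrt v) \<ge> 1 / (2
  sqrt (v + 1)).\<close>

lemma sqrt_add_le_gain:
  assumes v: "v > 0" and d: "d \<ge> 1"
  shows "sqrt (v + d) \<le> sqrt v + d / (2 * sqrt v) - 1 / (8 * (v + 1) * sqrt v)"
proof -
  have "(sqrt (v + 1) - sqrt v) * (sqrt (v + 1) + sqrt v) = 1"
    using v by (simp add: algebra_simps)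
  then have "sqrt (v + 1) - sqrt v = 1 / (sqrt (v + 1) + sqrt v)"
    using v add_pos_pos[of "sqrt (v + 1)" "sqrt v"] by (simp add: eq_divide_eq)
  also have "\<dots> \<ge> 1 / (2 * sqrt (v + 1))"
    using v by (intro divide_left_mono) (auto intro!: mult_pos_pos add_pos_pos)
  finally have "1 / (2 * sqrt (v + 1)) \<le> sqrt (v + 1) - sqrt v" .
  also have "\<dots> \<le> sqrt (v + d) - sqrt v" using d by simp
  finally have "(1 / (2 * sqrt (v + 1)))\<^sup>2 \<le> (sqrt (v + d) - sqrt v)\<^sup>2"
    using v by (intro power_mono) auto
  moreover have "(1 / (2 * sqrt (v + 1)))\<^sup>2 = 1 / (4 * (v + 1))"
    using v by (simp add: power_divide power_mult_distrib)
  ultimately have "1 / (4 * (v + 1)) / (2 * sqrt v) \<le> (sqrt (v + d) - sqrt v)\<^sup>2 / (2 * sqrt v)"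
    using v by (intro divide_right_mono) auto
  moreover have "1 / (4 * (v + 1)) / (2 * sqrt v) = 1 / (8 * (v + 1) * sqrt v)" by simp
  moreover have "sqrt (v + d) = sqrt v + d / (2 * sqrt v) - (sqrt (v + d) - sqrt v)\<^sup>2 / (2 * sqrt v)"
    by (rule sqrt_add_eq) (use v d in auto)
  ultimately show ?thesis by linarith
qed

context tree_walk
begin

definition stays_below :: "real \<Rightarrow> nat \<Rightarrow> nat \<Rightarrow> nat \<Rightarrow> bool" where
  "stays_below R N n j \<longleftrightarrow> (\<forall>k\<in>{N..n}. Z k (j div B ^ (n - k)) < - R)"

lemma stays_below_child:
  assumes "i < B" "N \<le> n"
  shows "stays_below R N (Suc n) (B * j + i) \<longleftrightarrow> stays_below R N n j \<and> Z (Suc n) (B * j + i) < - R"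
proof -
  have "(B * j + i) div B ^ (Suc n - k) = j div B ^ (n - k)" if "k \<le> n" for k
    using that assms by (simp add: Suc_diff_le div_mult2_eq)
  moreover have "{N..Suc n} = insert (Suc n) {N..n}" using assms by auto
  ultimately show ?thesis by (auto simp: stays_below_def)
qed

text \<open>The child given by \<open>down\<close> gains 1 / (8 (v + 1) sqrt v), and the drift costs
  at most B K e^(-v) / (2 sqrt v). The term 32 B K of the threshold makes the cost at most half of
  the gain; the term K keeps the arguments of all square roots nonnegative.\<close>

lemma sqrt_drift:
  assumes R: "Z n j < - (1 + K + 32 * B * K)"
  defines "v \<equiv> - Z n j"
  shows "(\<Sum>i<B. sqrt (- Z (Suc n) (B * j + i))) \<le> B * sqrt v - 1 / (16 * (v + 1) * sqrt v)"
proof -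
  have BK: "B * K > 0" using B_pos K_pos by simp
  have v: "v > 1" "v > K" "v > 32 * B * K" using R K_pos BK by (auto simp: v_def)
  define d where "d i = - (Z (Suc n) (B * j + i) - Z n j)" for i
  have Zd: "- Z (Suc n) (B * j + i) = v + d i" for i by (simp add: d_def v_def)
  have dK: "\<bar>d i\<bar> \<le> K" if "i < B" for i using step[OF that, of n j] by (simp add: d_def)
  obtain k where k: "k < B" "Z (Suc n) (B * j + k) \<le> Z n j - 1" using down by blast
  have "(\<Sum>i<B. sqrt (v + d i)) \<le> (\<Sum>i<B. sqrt v + d i / (2 * sqrt v)) - 1 / (8 * (v + 1) * sqrt v)"
  proof (rule sum_le_with_gain[OF _ k(1)])
    fix i assume "i < B"
    then show "sqrt (v + d i) \<le> sqrt v + d i / (2 * sqrt v)"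
      using dK[of i] v by (intro sqrt_add_le) auto
  next
    show "sqrt (v + d k) \<le> sqrt v + d k / (2 * sqrt v) - 1 / (8 * (v + 1) * sqrt v)"
      using k v by (intro sqrt_add_le_gain) (auto simp: d_def)
  qed
  also have "(\<Sum>i<B. sqrt v + d i / (2 * sqrt v)) = B * sqrt v + (\<Sum>i<B. d i) / (2 * sqrt v)"
    by (simp add: sum.distrib sum_divide_distrib)
  also have "(\<Sum>i<B. d i) \<le> B * (K * exp (- v))"
    using drift_low[of n j] by (simp add: d_def v_def sum_subtractf abs_le_iff sum_negf)
  then have "(\<Sum>i<B. d i) / (2 * sqrt v) \<le> B * (K * exp (- v)) / (2 * sqrt v)"
    using v by (intro divide_right_mono) auto
  also have "B * (K * exp (- v)) \<le> 1 / (8 * (v + 1))"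
  proof -
    have "1 + v / 2 \<le> exp (v / 2)" by (rule exp_ge_add_one_self)
    then have "(1 + v / 2) ^ 2 \<le> exp (v / 2) ^ 2" using v by (intro power_mono) auto
    also have "\<dots> = exp v" by (simp add: exp_double[symmetric])
    finally have e: "(1 + v / 2)\<^sup>2 \<le> exp v" .
    have "8 * (B * K) * (v + 1) \<le> v / 4 * (v + 1)" using v by (intro mult_right_mono) auto
    also have "\<dots> \<le> (1 + v / 2)\<^sup>2" using v by (simp add: power2_eq_square algebra_simps)
    also note e
    finally show ?thesis using v by (simp add: exp_minus field_simps)
  qed
  then have "B * (K * exp (- v)) / (2 * sqrt v) \<le> 1 / (8 * (v + 1)) / (2 * sqrt v)"
    using v by (intro divide_right_mono) auto
  finally have "(\<Sum>i<B. sqrt (v + d i)) \<le> B * sqrt v + 1 / (8 * (v + 1)) / (2 * sqrt v) - 1 / (8 * (v + 1) * sqrt v)"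
    by linarith
  also have "1 / (8 * (v + 1)) / (2 * sqrt v) = 1 / (16 * (v + 1) * sqrt v)" by simp
  also have "1 / (8 * (v + 1) * sqrt v) = 2 * (1 / (16 * (v + 1) * sqrt v))"
    by (simp only: mult.assoc) simp
  finally show ?thesis unfolding Zd by linarith
qed

text \<open>The mean w of sqrt (-Z) over the surviving nodes loses at least \<gamma> / B per step,
  so \<gamma> is summable and tends to 0. Survivors with -Z \<le> Q have density at most \<gamma> /
  g Q; those with -Z > Q have density at most w N / sqrt Q by Markov's inequality. Let n grow first
  and Q afterwards.\<close>

lemma stays_below_density_tendsto_0:
  defines "R \<equiv> 1 + K + 32 * B * K"
  shows "(\<lambda>n. card {j. j < B ^ n \<and> stays_below R N n j} / B ^ n) \<longlonglongrightarrow> 0"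
proof -
  define g where "g v = 1 / (16 * (v + 1) * sqrt v)" for v :: real
  have BK: "B * K > 0" using B_pos K_pos by simp
  have R1: "R > 1" using BK K_pos by (simp add: R_def)
  define W where "W n j = of_bool (stays_below R N n j) * sqrt (- Z n j)" for n j
  define G where "G n j = of_bool (stays_below R N n j) * g (- Z n j)" for n j
  have below: "Z n j < - R" if "stays_below R N n j" "N \<le> n" for n j
    using that by (auto simp: stays_below_def dest: bspec[of _ _ n])
  have nonneg: "W n j \<ge> 0" "G n j \<ge> 0" if "N \<le> n" for n j
    using below[of n j] that R1 by (auto simp: W_def G_def g_def)
  have WG: "(\<Sum>i<B. W (Suc n) (B * j + i)) \<le> B * W n j - G n j" if "N \<le> n" for n j
  proof (cases "stays_below R N n j")
    case True
    have Z: "Z n j < - R" using below[OF True that] .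
    have "(\<Sum>i<B. W (Suc n) (B * j + i)) \<le> (\<Sum>i<B. sqrt (- Z (Suc n) (B * j + i)))"
    proof (intro sum_mono)
      fix i assume i: "i \<in> {..<B}"
      then have "- Z (Suc n) (B * j + i) \<ge> 0"
        using Z step[of i n j] R_def BK by auto
      then show "W (Suc n) (B * j + i) \<le> sqrt (- Z (Suc n) (B * j + i))"
        by (simp add: W_def)
    qed
    also have "\<dots> \<le> B * sqrt (- Z n j) - g (- Z n j)"
      using sqrt_drift[of n j] Z by (simp add: R_def g_def)
    finally show ?thesis using True by (simp add: W_def G_def)
  next
    case False
    then have "W (Suc n) (B * j + i) = 0" if "i < B" for i
      using that \<open>N \<le> n\<close> by (simp add: W_def stays_below_child)
    then show ?thesis using False by (simp add: W_def G_def)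
  qed
  define w where "w n = (\<Sum>j<B ^ n. W n j) / B ^ n" for n
  define \<gamma> where "\<gamma> n = (\<Sum>j<B ^ n. G n j) / B ^ n" for n
  have w_nonneg: "w n \<ge> 0" and \<gamma>_nonneg: "\<gamma> n \<ge> 0" if "N \<le> n" for n
    using nonneg[OF that] by (auto simp: w_def \<gamma>_def intro!: divide_nonneg_nonneg sum_nonneg)
  have w_step: "w (Suc n) \<le> w n - \<gamma> n / B" if "N \<le> n" for n
  proof -
    have "(\<Sum>j<B ^ Suc n. W (Suc n) j) = (\<Sum>j<B ^ n. \<Sum>i<B. W (Suc n) (B * j + i))"
      by (rule sum_power_Suc_group)
    also have "\<dots> \<le> (\<Sum>j<B ^ n. B * W n j - G n j)" by (intro sum_mono WG that)
    also have "\<dots> = B * (\<Sum>j<B ^ n. W n j) - (\<Sum>j<B ^ n. G n j)"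
      by (simp add: sum_subtractf sum_distrib_left)
    finally have "w (Suc n) \<le> (B * (\<Sum>j<B ^ n. W n j) - (\<Sum>j<B ^ n. G n j)) / B ^ Suc n"
      unfolding w_def by (intro divide_right_mono) auto
    also have "\<dots> = w n - \<gamma> n / B" using B_pos by (simp add: w_def \<gamma>_def field_simps)
    finally show ?thesis .
  qed
  have sum_gamma: "(\<Sum>k<m. \<gamma> (N + k)) \<le> B * (w N - w (N + m))" for m
  proof (induction m)
    case (Suc m)
    have "\<gamma> (N + m) \<le> B * (w (N + m) - w (N + Suc m))"
      using w_step[of "N + m"] B_pos by (simp add: field_simps)
    with Suc show ?case by (simp add: algebra_simps)
  qed simp
  have w_le: "w (N + m) \<le> w N" for m
  proof -
    have "0 \<le> (\<Sum>k<m. \<gamma> (N + k))" by (intro sum_nonneg \<gamma>_nonneg) auto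
    also note sum_gamma
    finally show ?thesis using B_pos by (simp add: zero_le_mult_iff)
  qed
  have "summable (\<lambda>k. \<gamma> (N + k))"
  proof (rule summableI_nonneg_bounded)
    fix m
    have "B * (w N - w (N + m)) \<le> B * w N" using w_nonneg[of "N + m"] by (intro mult_left_mono) auto
    then show "(\<Sum>k<m. \<gamma> (N + k)) \<le> B * w N" using sum_gamma[of m] by linarith
  qed (auto intro: \<gamma>_nonneg)
  then have gamma_lim: "(\<lambda>k. \<gamma> (N + k)) \<longlonglongrightarrow> 0" by (rule summable_LIMSEQ_zero)
  define P where "P n = card {j. j < B ^ n \<and> stays_below R N n j} / B ^ n" for n
  have P_le: "P (N + m) \<le> \<gamma> (N + m) / g Q + w N / sqrt Q" if Q: "Q > R" for Q m
  proof -
    let ?n = "N + m"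
    have gQ: "g Q > 0" using Q R1 by (simp add: g_def)
    have "real (card {j. j < B ^ ?n \<and> stays_below R N ?n j}) = (\<Sum>j<B ^ ?n. of_bool (stays_below R N ?n j))"
    proof -
      have "{j. j < B ^ ?n \<and> stays_below R N ?n j} = {..<B ^ ?n} \<inter> {j. stays_below R N ?n j}" by auto
      then show ?thesis by (simp add: of_bool_def sum.If_cases)
    qed
    also have "\<dots> \<le> (\<Sum>j<B ^ ?n. G ?n j / g Q + W ?n j / sqrt Q)"
    proof (intro sum_mono)
      fix j
      show "of_bool (stays_below R N ?n j) \<le> G ?n j / g Q + W ?n j / sqrt Q"
      proof (cases "stays_below R N ?n j")
        case True
        have v: "- Z ?n j > R" using below[OF True] by simp
        show ?thesis
        proof (cases "- Z ?n j \<le> Q")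
          case le: True
          have "g Q \<le> g (- Z ?n j)" unfolding g_def
            using v R1 le by (intro divide_left_mono mult_mono mult_pos_pos) auto
          then have "1 \<le> G ?n j / g Q" using True gQ by (simp add: G_def)
          moreover have "0 \<le> W ?n j / sqrt Q" using nonneg[of ?n] Q R1 by simp
          ultimately show ?thesis using True by simp
        next
          case False
          then have "1 \<le> W ?n j / sqrt Q" using True Q R1 by (simp add: W_def)
          moreover have "0 \<le> G ?n j / g Q" using nonneg[of ?n] gQ by simp
          ultimately show ?thesis using True by simp
        qed
      next
        case False
        then show ?thesis by (simp add: G_def W_def)
      qed
    qed
    also have "\<dots> = (\<Sum>j<B ^ ?n. G ?n j) / g Q + (\<Sum>j<B ^ ?n. W ?n j) / sqrt Q"
      by (simp add: sum.distrib sum_divide_distrib)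
    finally have "P ?n \<le> ((\<Sum>j<B ^ ?n. G ?n j) / g Q + (\<Sum>j<B ^ ?n. W ?n j) / sqrt Q) / B ^ ?n"
      unfolding P_def by (intro divide_right_mono) auto
    also have "\<dots> = \<gamma> ?n / g Q + w ?n / sqrt Q" by (simp add: \<gamma>_def w_def add_divide_distrib mult.commute)
    also have "w ?n / sqrt Q \<le> w N / sqrt Q" using w_le Q R1 by (intro divide_right_mono) auto
    finally show ?thesis by simp
  qed
  have "(\<lambda>m. P (N + m)) \<longlonglongrightarrow> 0"
  proof (rule LIMSEQ_I)
    fix e :: real assume e: "e > 0"
    \<comment> \<open>The square gives sqrt Q > 2 w N / e, which puts the Markov term below e /
      2.\<close>
    define Q where "Q = R + 1 + (2 * w N / e)\<^sup>2"
    have Q: "Q > R" "Q > 0" using R1 by (auto simp: Q_def add_pos_nonneg)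
    have gQ: "g Q > 0" using Q by (simp add: g_def)
    have "2 * w N / e < sqrt Q"
      using R1 by (intro real_less_rsqrt) (simp add: Q_def)
    then have wQ: "w N / sqrt Q < e / 2" using e Q by (simp add: field_simps)
    obtain m0 where m0: "\<And>m. m \<ge> m0 \<Longrightarrow> norm (\<gamma> (N + m) - 0) < e / 2 * g Q"
      using LIMSEQ_D[OF gamma_lim, of "e / 2 * g Q"] e gQ by auto
    show "\<exists>m0. \<forall>m\<ge>m0. norm (P (N + m) - 0) < e"
    proof (intro exI allI impI)
      fix m assume "m \<ge> m0"
      then have "\<gamma> (N + m) < e / 2 * g Q" using m0 by force
      then have "\<gamma> (N + m) / g Q < e / 2" using gQ by (simp add: field_simps)
      then have "P (N + m) < e" using P_le[OF Q(1), of m] wQ by linarith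
      moreover have "P (N + m) \<ge> 0" by (simp add: P_def)
      ultimately show "norm (P (N + m) - 0) < e" by simp
    qed
  qed
  then have "P \<longlonglongrightarrow> 0"
    using LIMSEQ_offset[of P N 0] by (simp add: add.commute)
  then show ?thesis by (simp add: P_def[abs_def])
qed

end

section \<open>Almost sure statements for base-\<open>B\<close> expansions\<close>

lemma measure_digit_set:
  fixes N :: nat and P :: "nat \<Rightarrow> bool"
  assumes "N > 0"
  defines "S \<equiv> {y\<in>{0..<1::real}. P (nat \<lfloor>N * y\<rfloor>)}"
  shows "S \<in> sets lborel" "emeasure lborel S < \<infinity>" "measure lborel S \<le> card {j. j < N \<and> P j} / N"
proof -
  let ?J = "{j. j < N \<and> P j}"
  have S: "S = (\<Union>j\<in>?J. {real j / N..<(real j + 1) / N})"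
  proof (rule set_eqI, rule iffI)
    fix y assume y: "y \<in> S"
    let ?j = "nat \<lfloor>N * y\<rfloor>"
    have "0 \<le> N * y" "N * y < N" using y assms by (auto simp: S_def)
    then have "\<lfloor>N * y\<rfloor> < int N" by (simp add: floor_less_iff)
    then have "?j < N" using \<open>N > 0\<close> by (simp add: nat_less_iff)
    moreover have "real ?j \<le> N * y" "N * y < real ?j + 1" using \<open>0 \<le> N * y\<close> by linarith+
    then have "y \<in> {real ?j / N..<(real ?j + 1) / N}" using assms by (simp add: field_simps)
    ultimately show "y \<in> (\<Union>j\<in>?J. {real j / N..<(real j + 1) / N})" using y by (auto simp: S_def)
  next
    fix y assume "y \<in> (\<Union>j\<in>?J. {real j / N..<(real j + 1) / N})"
    then obtain j :: nat where j: "j < N" "P j" "j / N \<le> y" "y < (real j + 1) / N"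
      by (auto simp: add.commute)
    then have jy: "real j \<le> N * y" "N * y < real j + 1" using assms by (auto simp: field_simps)
    then have "\<lfloor>N * y\<rfloor> = int j" by (intro floor_unique) auto
    moreover have "y \<ge> 0" using j(3) by (smt (verit) divide_nonneg_nonneg of_nat_0_le_iff)
    moreover have "real j + 1 \<le> N" using j(1) by linarith
    then have "(real j + 1) / N \<le> 1" using assms by simp
    then have "y < 1" using j(4) by linarith
    ultimately show "y \<in> S" using j by (simp add: S_def)
  qed
  show "S \<in> sets lborel" unfolding S by auto
  have "emeasure lborel S \<le> (\<Sum>j\<in>?J. emeasure lborel {real j / N..<(real j + 1) / N})"
    unfolding S by (intro emeasure_subadditive_finite) auto
  also have "\<dots> = (\<Sum>j\<in>?J. ennreal (1 / N))"
    using assms by (intro sum.cong refl) (simp add: divide_right_mono diff_divide_distrib[symmetric])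
  also have "\<dots> = ennreal (card ?J / N)"
    by (simp add: ennreal_of_nat_eq_real_of_nat ennreal_mult[symmetric])
  finally have e: "emeasure lborel S \<le> ennreal (card ?J / N)" .
  then show "emeasure lborel S < \<infinity>" by (simp add: order_le_less_trans)
  from e show "measure lborel S \<le> card ?J / N"
    unfolding measure_def by (intro enn2real_leI) auto
qed

text \<open>Dropping the last n - k base-B digits: this identifies ancestors in the tree with
  shorter prefixes of the expansion of y.\<close>

lemma nat_floor_power_div:
  fixes y :: real
  assumes "k \<le> n" "B > 0" "y \<ge> 0"
  shows "nat \<lfloor>real B ^ n * y\<rfloor> div B ^ (n - k) = nat \<lfloor>real B ^ k * y\<rfloor>"
proof -
  have "real B ^ n = real B ^ (n - k) * real B ^ k" using assms by (simp flip: power_add)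
  then have "real B ^ n * y / real_of_int (int B ^ (n - k)) = real B ^ k * y" using assms by simp
  then have "\<lfloor>real B ^ k * y\<rfloor> = \<lfloor>real B ^ n * y\<rfloor> div int B ^ (n - k)"
    by (metis floor_divide_real_eq_div of_nat_0_le_iff of_nat_power)
  moreover have "\<lfloor>real B ^ n * y\<rfloor> \<ge> 0" using assms by simp
  ultimately show ?thesis by (simp add: nat_div_distrib nat_power_eq)
qed

context tree_walk
begin

text \<open>If the visits stop before time N, then y lies in T N n for every n. The intersection of
  these sets is null because its measure is below every density of
  \<open>stays_below_density_tendsto_0\<close>; countably many N remain.\<close>

lemma AE_infinitely_often:
  defines "R \<equiv> 1 + K + 32 * B * K"
  shows "AE y in lborel. y \<in> {0..<1} \<longrightarrow> infinite {n. Z n (nat \<lfloor>real B ^ n * y\<rfloor>) \<ge> - R}"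
proof -
  define T where "T N n = {y\<in>{0..<1}. stays_below R N n (nat \<lfloor>real B ^ n * y\<rfloor>)}" for N n
  have T: "T N n \<in> sets lborel" "emeasure lborel (T N n) < \<infinity>"
    "measure lborel (T N n) \<le> card {j. j < B ^ n \<and> stays_below R N n j} / B ^ n" for N n
    using measure_digit_set[of "B ^ n" "stays_below R N n"] B_pos by (simp_all add: T_def)
  have "AE y in lborel. y \<notin> (\<Inter>n. T N n)" for N
  proof -
    have m: "(\<Inter>n. T N n) \<in> sets lborel" using T by (intro sets.countable_INT) auto
    have le: "measure lborel (\<Inter>n. T N n) \<le> card {j. j < B ^ n \<and> stays_below R N n j} / B ^ n" for n
    proof -
      have "measure lborel (\<Inter>n. T N n) \<le> measure lborel (T N n)"
        using T m by (intro measure_mono_fmeasurable) (auto simp: fmeasurable_def)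
      then show ?thesis using T(3)[of N n] by linarith
    qed
    have "(\<lambda>n. card {j. j < B ^ n \<and> stays_below R N n j} / B ^ n) \<longlonglongrightarrow> 0"
      unfolding R_def by (rule stays_below_density_tendsto_0)
    then have "measure lborel (\<Inter>n. T N n) \<le> 0"
      by (rule LIMSEQ_le_const) (use le in auto)
    then have "measure lborel (\<Inter>n. T N n) = 0" using measure_nonneg[of lborel "\<Inter>n. T N n"] by linarith
    moreover have "emeasure lborel (\<Inter>n. T N n) \<le> emeasure lborel (T N 0)"
      using T by (intro emeasure_mono) auto
    then have "emeasure lborel (\<Inter>n. T N n) < \<infinity>" using T(2)[of N 0] by (rule order_le_less_trans)
    ultimately have "(\<Inter>n. T N n) \<in> null_sets lborel"
      using m by (simp add: null_sets_def measure_eq_emeasure_eq_ennreal emeasure_eq_ennreal_measure)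
    then show ?thesis by (rule AE_not_in)
  qed
  then have "AE y in lborel. \<forall>N. y \<notin> (\<Inter>n. T N n)" by (simp add: AE_all_countable)
  then show ?thesis
  proof (rule AE_mp, intro AE_I2 impI notI)
    fix y :: real
    assume *: "\<forall>N. y \<notin> (\<Inter>n. T N n)" and y: "y \<in> {0..<1}"
      and fin: "finite {n. Z n (nat \<lfloor>real B ^ n * y\<rfloor>) \<ge> - R}"
    from iffD1[OF finite_nat_set_iff_bounded fin]
    obtain N where "\<forall>n\<in>{n. Z n (nat \<lfloor>real B ^ n * y\<rfloor>) \<ge> - R}. n < N" ..
    then have N: "Z n (nat \<lfloor>real B ^ n * y\<rfloor>) < - R" if "n \<ge> N" for n
      using that linorder_not_le by (metis (mono_tags, lifting) mem_Collect_eq)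
    have "y \<in> T N n" for n
    proof -
      have "Z k (nat \<lfloor>real B ^ n * y\<rfloor> div B ^ (n - k)) < - R" if "k \<in> {N..n}" for k
      proof -
        have "nat \<lfloor>real B ^ n * y\<rfloor> div B ^ (n - k) = nat \<lfloor>real B ^ k * y\<rfloor>"
          using nat_floor_power_div[of k n B y] that y B_pos by simp
        then show ?thesis using N[of k] that by simp
      qed
      then show ?thesis using y by (simp add: T_def stays_below_def)
    qed
    then show False using * by blast
  qed
qed

lemma visits_path:
  assumes "y \<ge> 0"
  shows "visits R n (nat \<lfloor>real B ^ n * y\<rfloor>) = (\<Sum>k<n. of_bool (Z k (nat \<lfloor>real B ^ k * y\<rfloor>) \<ge> - R))"
  unfolding visits_def
proof (intro sum.cong refl)
  fix k assume "k \<in> {..<n}"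
  then show "of_bool (- R \<le> Z k (nat \<lfloor>real B ^ n * y\<rfloor> div B ^ (n - k)))
      = (of_bool (- R \<le> Z k (nat \<lfloor>real B ^ k * y\<rfloor>)) :: real)"
    using nat_floor_power_div[of k n B y] assms B_pos by simp
qed

lemma AE_frequency_tendsto_0:
  "AE y in lborel. y \<in> {0..<1} \<longrightarrow>
    (\<lambda>n. (\<Sum>k<n. of_bool (Z k (nat \<lfloor>real B ^ k * y\<rfloor>) \<ge> - R)) / n) \<longlonglongrightarrow> (0::real)"
proof -
  define T where "T \<eta> n = {y\<in>{0..<1}. \<eta> * n \<le> visits R n (nat \<lfloor>real B ^ n * y\<rfloor>)}" for \<eta> n
  have ev: "AE y in lborel. \<forall>\<^sub>F n in sequentially. y \<notin> T \<eta> n" if \<eta>: "\<eta> > 0" for \<eta>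
  proof -
    obtain c \<theta> :: real where \<theta>: "\<theta> > 0" "\<theta> < 1"
      "\<And>n. card {j. j < B ^ n \<and> visits R n j \<ge> \<eta> * n} \<le> c * \<theta> ^ n * B ^ n"
      using visits_large_deviation[OF \<eta>] by metis
    have T: "T \<eta> n \<in> sets lborel" "emeasure lborel (T \<eta> n) < \<infinity>" "measure lborel (T \<eta> n) \<le> c * \<theta> ^ n" for n
    proof -
      note m = measure_digit_set[of "B ^ n" "\<lambda>j. visits R n j \<ge> \<eta> * n"]
      show "T \<eta> n \<in> sets lborel" "emeasure lborel (T \<eta> n) < \<infinity>" using m B_pos by (simp_all add: T_def)
      have "measure lborel (T \<eta> n) \<le> card {j. j < B ^ n \<and> visits R n j \<ge> \<eta> * n} / B ^ n"
        using m B_pos by (simp add: T_def)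
      also have "\<dots> \<le> c * \<theta> ^ n" using \<theta>(3)[of n] B_pos by (simp add: divide_le_eq)
      finally show "measure lborel (T \<eta> n) \<le> c * \<theta> ^ n" .
    qed
    have "summable (\<lambda>n. measure lborel (T \<eta> n))"
    proof (rule summable_comparison_test')
      show "summable (\<lambda>n. c * \<theta> ^ n)" using \<theta> by (intro summable_mult summable_geometric) simp
      show "norm (measure lborel (T \<eta> n)) \<le> c * \<theta> ^ n" if "n \<ge> 0" for n using T(3)[of n] by simp
    qed
    from borel_cantelli_AE1[OF T(1) T(2) this] show ?thesis by simp
  qed
  have "AE y in lborel. \<forall>m. \<forall>\<^sub>F n in sequentially. y \<notin> T (1 / Suc m) n"
    unfolding AE_all_countable by (intro allI ev) simp
  then show ?thesis
  proof (rule AE_mp, intro AE_I2 impI)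
    fix y :: real
    assume *: "\<forall>m. \<forall>\<^sub>F n in sequentially. y \<notin> T (1 / Suc m) n" and y: "y \<in> {0..<1}"
    let ?s = "\<lambda>n. (\<Sum>k<n. of_bool (Z k (nat \<lfloor>real B ^ k * y\<rfloor>) \<ge> - R)) :: real"
    show "(\<lambda>n. ?s n / n) \<longlonglongrightarrow> 0"
    proof (rule LIMSEQ_I)
      fix e :: real assume "e > 0"
      then obtain m where m: "inverse (Suc m) < e" using reals_Archimedean by blast
      have "\<forall>\<^sub>F n in sequentially. y \<notin> T (1 / Suc m) n \<and> n > 0"
        using * eventually_gt_at_top[of "0::nat"] by (auto intro: eventually_conj)
      then have "\<forall>\<^sub>F n in sequentially. norm (?s n / n - 0) < e"
      proof (rule eventually_mono, elim conjE)
        fix n :: nat assume "y \<notin> T (1 / Suc m) n" "n > 0"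
        then have "?s n < 1 / Suc m * n" using y visits_path[of y R n] by (auto simp: T_def not_le)
        then have "?s n / n < 1 / Suc m" using \<open>n > 0\<close> by (simp add: divide_less_eq)
        moreover have "?s n / n \<ge> 0" by (intro divide_nonneg_nonneg sum_nonneg) auto
        ultimately show "norm (?s n / n - 0) < e" using m by (simp add: inverse_eq_divide)
      qed
      then show "\<exists>N. \<forall>n\<ge>N. norm (?s n / n - 0) < e" by (simp add: eventually_sequentially)
    qed
  qed
qed

end

section \<open>Fiber dynamics over the doubling map\<close>

lemma integral_halves:
  fixes F :: "real \<Rightarrow> real"
  assumes F: "continuous_on {0..1} F"
  shows "integral {0..1} (\<lambda>t. F (t / 2)) + integral {0..1} (\<lambda>t. F ((1 + t) / 2)) = 2 * integral {0..1} F"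
proof -
  have int: "F integrable_on {a..b}" if "0 \<le> a" "b \<le> 1" for a b
    by (rule integrable_continuous_interval) (rule continuous_on_subset[OF F], use that in auto)
  have "((\<lambda>t. F (t / 2)) has_integral 2 * integral {0..1/2} F) {0..1}"
    using has_integral_affinity'[of F "integral {0..1/2} F" 0 "1/2" "1/2" 0] int[of 0 "1/2"]
    by (simp add: integrable_integral mult.commute)
  moreover have "((\<lambda>t. F ((1 + t) / 2)) has_integral 2 * integral {1/2..1} F) {0..1}"
    using has_integral_affinity'[of F "integral {1/2..1} F" "1/2" 1 "1/2" "1/2"] int[of "1/2" 1]
    by (simp add: integrable_integral mult.commute add_divide_distrib add.commute)
  moreover have "integral {0..1/2} F + integral {1/2..1} F = integral {0..1} F"
    by (rule Henstock_Kurzweil_Integration.integral_combine) (use int[of 0 1] in auto)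
  ultimately show ?thesis by (simp add: integral_unique)
qed

text \<open>Accumulates a one-step drift bound over m generations below node j. It serves to pass
  from the binary tree to the tree with B = 2^m, with g equal to the averages and to their
  negatives.\<close>

lemma binary_tree_sum_le:
  fixes g :: "nat \<Rightarrow> nat \<Rightarrow> real"
  assumes "\<And>k i. k < m \<Longrightarrow> i < 2 ^ k \<Longrightarrow>
    (\<Sum>l<2. g (Suc (n + k)) (2 * (2 ^ k * j + i) + l)) \<le> 2 * (g (n + k) (2 ^ k * j + i) + c)"
  shows "(\<Sum>i<2 ^ m. g (n + m) (2 ^ m * j + i)) \<le> 2 ^ m * (g n j + m * c)"
  using assms
proof (induction m)
  case (Suc m)
  have "(\<Sum>i<2 ^ Suc m. g (n + Suc m) (2 ^ Suc m * j + i))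
      = (\<Sum>i<2 ^ m. \<Sum>l<2. g (n + Suc m) (2 ^ Suc m * j + (2 * i + l)))"
    by (rule sum_power_Suc_group)
  also have "\<dots> = (\<Sum>i<2 ^ m. \<Sum>l<2. g (Suc (n + m)) (2 * (2 ^ m * j + i) + l))"
    by (simp add: algebra_simps)
  also have "\<dots> \<le> (\<Sum>i<2 ^ m. 2 * (g (n + m) (2 ^ m * j + i) + c))"
    by (intro sum_mono Suc.prems) auto
  also have "\<dots> = 2 * (\<Sum>i<2 ^ m. g (n + m) (2 ^ m * j + i)) + 2 * 2 ^ m * c"
    by (simp add: sum.distrib sum_distrib_left distrib_left)
  also have "\<dots> \<le> 2 * (2 ^ m * (g n j + m * c)) + 2 * 2 ^ m * c"
    using Suc by (intro add_right_mono mult_left_mono Suc.IH) auto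
  also have "\<dots> = 2 ^ Suc m * (g n j + Suc m * c)" by (simp add: algebra_simps)
  finally show ?case .
qed simp

text \<open>
  \<open>dyadic_branch f u0 n j t\<close> is the state after \<open>n\<close> steps of the fiber dynamics over the base
  point \<open>(j + t) / 2 ^ n\<close>; see \<open>base_orbit_eq_dyadic_branch\<close>.
\<close>

primrec dyadic_branch :: "(real \<Rightarrow> real \<Rightarrow> real) \<Rightarrow> real \<Rightarrow> nat \<Rightarrow> nat \<Rightarrow> real \<Rightarrow> real" where
  "dyadic_branch f u0 0 j t = u0"
| "dyadic_branch f u0 (Suc n) j t =
     f ((real (j mod 2) + t) / 2) (dyadic_branch f u0 n (j div 2) ((real (j mod 2) + t) / 2))"

primrec base_orbit :: "(real \<Rightarrow> real \<Rightarrow> real) \<Rightarrow> real \<Rightarrow> nat \<Rightarrow> real \<Rightarrow> real" where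
  "base_orbit f u0 0 y = u0"
| "base_orbit f u0 (Suc n) y = f ((E2 ^^ n) y) (base_orbit f u0 n y)"

lemma E2_eq_frac: "E2 y = frac (2 * y)"
  by (simp add: E2_def frac_def)

lemma floor_double: "\<lfloor>2 * z\<rfloor> = 2 * \<lfloor>z\<rfloor> + (if frac z < 1 / 2 then 0 else 1)" for z :: real
  unfolding frac_def by (auto simp: floor_eq_iff) linarith+

lemma E2_funpow: "y \<in> {0..<1} \<Longrightarrow> (E2 ^^ n) y = frac (2 ^ n * y)"
proof (induction n)
  case 0
  then show ?case by (simp add: frac_eq)
next
  case (Suc n)
  have "frac (2 * frac z) = frac (2 * z)" for z :: real
  proof -
    have "2 * (z - of_int \<lfloor>z\<rfloor>) = 2 * z - real_of_int (2 * \<lfloor>z\<rfloor>)" by simp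
    then show ?thesis by (simp only: frac_def floor_diff_of_int of_int_diff)
  qed
  then show ?case using Suc by (simp add: E2_eq_frac mult.assoc)
qed

text \<open>With z = 2^n y, frac z = (d + frac (2 z)) / 2, where d is the last binary digit of the
  floor of 2 z. So d selects the inverse branch of \<open>E2\<close> that leads back one step, as
  the recursion of \<open>dyadic_branch\<close> does.\<close>

lemma base_orbit_eq_dyadic_branch:
  assumes y: "y \<in> {0..<1}"
  shows "base_orbit f u0 n y = dyadic_branch f u0 n (nat \<lfloor>2 ^ n * y\<rfloor>) (frac (2 ^ n * y))"
proof (induction n)
  case (Suc n)
  define z where "z = 2 ^ n * y"
  have z0: "\<lfloor>z\<rfloor> \<ge> 0" using y by (simp add: z_def)
  have eq: "nat \<lfloor>2 * z\<rfloor> = 2 * nat \<lfloor>z\<rfloor> + (if frac z < 1 / 2 then 0 else 1)"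
    using z0 by (simp add: floor_double nat_add_distrib nat_mult_distrib)
  have d: "nat \<lfloor>2 * z\<rfloor> div 2 = nat \<lfloor>z\<rfloor>" "nat \<lfloor>2 * z\<rfloor> mod 2 = (if frac z < 1 / 2 then 0 else 1)"
    unfolding eq by auto
  have "(real (nat \<lfloor>2 * z\<rfloor> mod 2) + frac (2 * z)) / 2 = frac z"
    unfolding d by (simp add: frac_def floor_double)
  then show ?case using Suc y d(1) by (simp add: z_def E2_funpow mult.assoc)
qed simp

text \<open>The constant 3 / 2 lies below the expansion 2 of the base. \<kappa> is a rate of descent
  near +oo with positive mean L, not assumed positive at each t. The point e is fixed by the inverse
  branch t -> (e + t) / 2 of the doubling map.\<close>

locale fiber_system =
  fixes f :: "real \<Rightarrow> real \<Rightarrow> real" and \<xi> \<kappa> :: "real \<Rightarrow> real" and K M L c :: real and e :: nat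
  assumes pos: "K > 0" "L > 0" "c > 0" and e: "e < 2"
    and f_lip_state: "t \<in> {0..1} \<Longrightarrow> \<bar>f t u - f t v\<bar> \<le> 3 / 2 * \<bar>u - v\<bar>"
    and f_lip_base: "s \<in> {0..1} \<Longrightarrow> t \<in> {0..1} \<Longrightarrow> \<bar>f s u - f t u\<bar> \<le> K * \<bar>s - t\<bar>"
    and f_step: "t \<in> {0..1} \<Longrightarrow> \<bar>f t u - u\<bar> \<le> K"
    and f_low: "t \<in> {0..1} \<Longrightarrow> \<bar>f t u - u - \<xi> t\<bar> \<le> K * exp u"
    and f_high: "t \<in> {0..1} \<Longrightarrow> u \<ge> M \<Longrightarrow> f t u \<le> u - \<kappa> t"
    and \<xi>: "(\<xi> has_integral 0) {0..1}"
    and \<kappa>: "(\<kappa> has_integral L) {0..1}"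
    and f_down: "f (real e) u \<le> u - c"
begin

context
  fixes u0 :: real
begin

abbreviation "w \<equiv> dyadic_branch f u0"

lemma f_lip:
  assumes "s \<in> {0..1}" "t \<in> {0..1}"
  shows "\<bar>f s u - f t v\<bar> \<le> K * \<bar>s - t\<bar> + 3 / 2 * \<bar>u - v\<bar>"
  using f_lip_base[OF assms, of u] f_lip_state[OF assms(2), of u v] by linarith

text \<open>2 K is the fixed point of l -> K / 2 + 3 / 4 * l: an inverse branch halves |s - t|, then
  a fiber step adds K times that distance and stretches the difference of states by at most 3 / 2.
  Hence the bound is uniform in n.\<close>

lemma w_lip:
  assumes "s \<in> {0..1}" "t \<in> {0..1}"
  shows "\<bar>w n j s - w n j t\<bar> \<le> 2 * K * \<bar>s - t\<bar>"
  using assms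
proof (induction n arbitrary: j s t)
  case 0
  then show ?case using pos by simp
next
  case (Suc n)
  let ?s = "(real (j mod 2) + s) / 2" and ?t = "(real (j mod 2) + t) / 2"
  have "real (j mod 2) \<in> {0..1}" by (cases "even j") auto
  then have st: "?s \<in> {0..1}" "?t \<in> {0..1}" using Suc.prems by auto
  have "?s - ?t = (s - t) / 2" by (simp add: add_divide_distrib diff_divide_distrib)
  then have st2: "\<bar>?s - ?t\<bar> = \<bar>s - t\<bar> / 2" by (simp only: abs_divide abs_numeral)
  then show ?case
    using f_lip[OF st, of "w n (j div 2) ?s" "w n (j div 2) ?t"] Suc.IH[OF st, of "j div 2"]
    unfolding dyadic_branch.simps st2 by linarith
qed

definition F :: "nat \<Rightarrow> nat \<Rightarrow> real \<Rightarrow> real" where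
  "F n j t = f t (w n j t)"

lemma F_lip:
  assumes "s \<in> {0..1}" "t \<in> {0..1}"
  shows "\<bar>F n j s - F n j t\<bar> \<le> 4 * K * \<bar>s - t\<bar>"
  using f_lip[OF assms, of "w n j s" "w n j t"] w_lip[OF assms, of n j] by (simp add: F_def)

lemma continuous_on_w: "continuous_on {0..1} (w n j)"
  and continuous_on_F: "continuous_on {0..1} (F n j)"
proof -
  show "continuous_on {0..1} (w n j)"
    by (rule lipschitz_on_continuous_on[of "2 * K"], rule lipschitz_onI)
      (use w_lip pos in \<open>auto simp: dist_real_def\<close>)
  show "continuous_on {0..1} (F n j)"
    by (rule lipschitz_on_continuous_on[of "4 * K"], rule lipschitz_onI)
      (use F_lip pos in \<open>auto simp: dist_real_def\<close>)
qed

definition A :: "nat \<Rightarrow> nat \<Rightarrow> real" where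
  "A n j = integral {0..1} (w n j)"

lemma A_has_integral: "(w n j has_integral A n j) {0..1}"
  unfolding A_def by (intro integrable_integral integrable_continuous_interval continuous_on_w)

lemma has_integral_abs_diff_le:
  fixes h :: "real \<Rightarrow> real"
  assumes "(h has_integral I) {0..1}" "\<And>t. t \<in> {0..1} \<Longrightarrow> \<bar>h t - a\<bar> \<le> b"
  shows "\<bar>I - a\<bar> \<le> b"
proof -
  have c: "((\<lambda>_::real. r) has_integral r) {0..1}" for r :: real
    using has_integral_const_real[of r 0 1] by simp
  have "h t \<le> a + b \<and> a - b \<le> h t" if "t \<in> {0..1}" for t
    using assms(2)[OF that] by linarith
  then have "I \<le> a + b" "a - b \<le> I"
    using has_integral_le[OF assms(1) c[of "a + b"]] has_integral_le[OF c[of "a - b"] assms(1)] by auto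
  then show ?thesis by linarith
qed

lemma A_w: "t \<in> {0..1} \<Longrightarrow> \<bar>A n j - w n j t\<bar> \<le> 2 * K"
proof (rule has_integral_abs_diff_le[OF A_has_integral])
  fix s :: real assume "t \<in> {0..1}" "s \<in> {0..1}"
  moreover from this have "2 * K * \<bar>s - t\<bar> \<le> 2 * K * 1"
    using pos by (intro mult_left_mono) auto
  ultimately show "\<bar>w n j s - w n j t\<bar> \<le> 2 * K" using w_lip[of s t n j] by simp
qed

text \<open>In the coordinate t of the parent interval the two children are the two halves. The
  drift of A is therefore the mean of F - w over uniform t, in which the integral of \<xi> appears
  exactly.\<close>

lemma A_children: "(\<Sum>l<2. A (Suc n) (2 * j + l)) = 2 * integral {0..1} (F n j)"
proof -
  have "w (Suc n) (2 * j) = (\<lambda>t. F n j (t / 2))" "w (Suc n) (2 * j + 1) = (\<lambda>t. F n j ((1 + t) / 2))"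
    by (simp_all add: F_def fun_eq_iff)
  then show ?thesis
    using integral_halves[OF continuous_on_F, of n j] by (simp add: A_def eval_nat_numeral)
qed

lemma A_step: "l < 2 \<Longrightarrow> \<bar>A (Suc n) (2 * j + l) - A n j\<bar> \<le> 3 * K"
proof (rule has_integral_abs_diff_le[OF A_has_integral])
  fix t :: real assume "l < 2" "t \<in> {0..1}"
  then have s: "(real l + t) / 2 \<in> {0..1}" by auto
  have "w (Suc n) (2 * j + l) t = f ((real l + t) / 2) (w n j ((real l + t) / 2))"
    using \<open>l < 2\<close> by simp
  then show "\<bar>w (Suc n) (2 * j + l) t - A n j\<bar> \<le> 3 * K"
    using f_step[OF s, of "w n j ((real l + t) / 2)"] A_w[OF s, of n j] by simp
qed

lemma drift_has_integral:
  "((\<lambda>t. F n j t - w n j t) has_integral (\<Sum>l<2. A (Suc n) (2 * j + l)) / 2 - A n j) {0..1}"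
  unfolding A_children using A_has_integral continuous_on_F
  by (auto intro!: has_integral_diff integrable_integral integrable_continuous_interval)

lemma A_drift_low:
  "\<bar>(\<Sum>l<2. A (Suc n) (2 * j + l)) - 2 * A n j\<bar> \<le> 2 * (K * exp (2 * K + A n j))"
proof -
  have "((\<lambda>t. F n j t - w n j t - \<xi> t) has_integral (\<Sum>l<2. A (Suc n) (2 * j + l)) / 2 - A n j - 0) {0..1}"
    by (intro has_integral_diff[OF drift_has_integral] \<xi>)
  then have "\<bar>(\<Sum>l<2. A (Suc n) (2 * j + l)) / 2 - A n j - 0 - 0\<bar> \<le> K * exp (2 * K + A n j)"
  proof (rule has_integral_abs_diff_le)
    fix t :: real assume t: "t \<in> {0..1}"
    have "K * exp (w n j t) \<le> K * exp (2 * K + A n j)"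
      using A_w[OF t, of n j] pos by (intro mult_left_mono) auto
    then show "\<bar>F n j t - w n j t - \<xi> t - 0\<bar> \<le> K * exp (2 * K + A n j)"
      using f_low[OF t, of "w n j t"] by (simp add: F_def)
  qed
  then show ?thesis by linarith
qed

lemma A_drift_high:
  assumes "A n j \<ge> M + 2 * K"
  shows "(\<Sum>l<2. A (Suc n) (2 * j + l)) \<le> 2 * (A n j - L)"
proof -
  have "(\<Sum>l<2. A (Suc n) (2 * j + l)) / 2 - A n j \<le> - L"
  proof (rule has_integral_le[OF drift_has_integral has_integral_neg[OF \<kappa>]])
    fix t :: real assume t: "t \<in> {0..1}"
    have "w n j t \<ge> M" using A_w[OF t, of n j] assms by linarith
    then show "F n j t - w n j t \<le> - \<kappa> t" using f_high[OF t, of "w n j t"] by (simp add: F_def)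
  qed
  then show ?thesis by (simp add: field_simps)
qed

lemma A_descendant: "i < 2 ^ k \<Longrightarrow> \<bar>A (n + k) (2 ^ k * j + i) - A n j\<bar> \<le> 3 * K * k"
proof (induction k arbitrary: i)
  case (Suc k)
  have i: "i div 2 < 2 ^ k" using Suc.prems by auto
  have eq: "2 ^ Suc k * j + i = 2 * (2 ^ k * j + i div 2) + i mod 2" by simp
  have "\<bar>A (Suc (n + k)) (2 * (2 ^ k * j + i div 2) + i mod 2) - A (n + k) (2 ^ k * j + i div 2)\<bar> \<le> 3 * K"
    by (rule A_step) simp
  then show ?case
    using Suc.IH[OF i] unfolding eq add_Suc_right of_nat_Suc distrib_left by linarith
qed simp

text \<open>The index appends the binary digit e to j k times, and t = e is fixed by the
  corresponding inverse branch. So all k fiber steps take place over the base point e, where each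
  descends by at least c.\<close>

lemma w_extreme_descendant: "w (n + k) (2 ^ k * j + e * (2 ^ k - 1)) (real e) \<le> w n j (real e) - k * c"
proof (induction k)
  case (Suc k)
  define J where "J = 2 ^ k * j + e * (2 ^ k - 1)"
  have J: "2 ^ Suc k * j + e * (2 ^ Suc k - 1) = 2 * J + e"
  proof -
    obtain N where "(2::nat) ^ k = Suc N" using not0_implies_Suc[of "2 ^ k"] by auto
    then show ?thesis by (simp add: J_def algebra_simps)
  qed
  have "(real e + real e) / 2 = real e" by simp
  then have "w (n + Suc k) (2 * J + e) (real e) = f (real e) (w (n + k) J (real e))"
    using e by simp
  also have "\<dots> \<le> w (n + k) J (real e) - c" by (rule f_down)
  also have "w (n + k) J (real e) \<le> w n j (real e) - k * c" using Suc by (simp add: J_def)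
  finally show ?case unfolding J by (simp add: algebra_simps)
qed simp

text \<open>One step of this walk is a block of m binary steps. The extreme descendant loses m c in
  w at t = e, and A is within 2 K of w at both ends of the block, so m c > 4 K + 1 leaves a descent
  of 1. Inside a block A moves by at most 3 K m, which accounts for that term in the exponential and
  in the raised level M.\<close>

lemma tree_walk_A:
  fixes m :: nat
  assumes mc: "m * c > 4 * K + 1"
  shows "tree_walk (2 ^ m) (\<lambda>n j. A (m * n) j)
    (3 * K * m + m * (K * exp (2 * K + 3 * K * m))) (M + 2 * K + 3 * K * m) L"
proof -
  define E where "E = K * exp (2 * K + 3 * K * m)"
  define K' where "K' = 3 * K * m + m * E"
  define M' where "M' = M + 2 * K + 3 * K * m"
  have m0: "m > 0" using mc pos by (cases m) auto
  have E: "E > 0" using pos by (simp add: E_def)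
  have K': "K' > 0" using pos m0 E by (simp add: K'_def add_pos_pos)
  have near: "\<bar>A (n + k) (2 ^ k * j + i) - A n j\<bar> \<le> 3 * K * m" if "k \<le> m" "i < 2 ^ k" for n k j i
  proof -
    have "3 * K * k \<le> 3 * K * m" using that pos by simp
    then show ?thesis using A_descendant[OF that(2), of n j] by linarith
  qed
  have desc_low: "\<bar>(\<Sum>l<2. A (Suc (n + k)) (2 * (2 ^ k * j + i) + l)) - 2 * A (n + k) (2 ^ k * j + i)\<bar>
      \<le> 2 * (E * exp (A n j))" if "k < m" "i < 2 ^ k" for n k j i
  proof -
    have "exp (2 * K + A (n + k) (2 ^ k * j + i)) \<le> exp (2 * K + 3 * K * m + A n j)"
      using near[of k i n j] that by simp
    then have "K * exp (2 * K + A (n + k) (2 ^ k * j + i)) \<le> E * exp (A n j)"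
      using pos by (simp add: E_def exp_add mult.assoc)
    then show ?thesis using A_drift_low[of "n + k" "2 ^ k * j + i"] by linarith
  qed
  have two_sided: "S \<le> 2 * (a + b) \<and> - S \<le> 2 * (- a + b)" if "\<bar>S - 2 * a\<bar> \<le> 2 * b" for S a b :: real
    using that by (simp add: abs_le_iff distrib_left)
  have "tree_walk (2 ^ m) (\<lambda>n j. A (m * n) j) K' M' L"
  proof (unfold_locales, goal_cases)
    case (4 i n j)
    moreover have "3 * K * m \<le> K'" using E by (simp add: K'_def)
    ultimately show ?case using near[of m i "m * n" j] by (simp add: add.commute)
  next
    case (5 n j)
    let ?a = "A (m * n) j"
    have up: "(\<Sum>i<2 ^ m. A (m * n + m) (2 ^ m * j + i)) \<le> 2 ^ m * (?a + m * (E * exp ?a))"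
    proof (rule binary_tree_sum_le)
      fix k i :: nat assume ki: "k < m" "i < 2 ^ k"
      show "(\<Sum>l<2. A (Suc (m * n + k)) (2 * (2 ^ k * j + i) + l))
        \<le> 2 * (A (m * n + k) (2 ^ k * j + i) + E * exp ?a)"
        using two_sided[OF desc_low[OF ki, of "m * n" j]] by (rule conjunct1)
    qed
    have "(\<Sum>i<2 ^ m. - A (m * n + m) (2 ^ m * j + i)) \<le> 2 ^ m * (- ?a + m * (E * exp ?a))"
    proof (rule binary_tree_sum_le)
      fix k i :: nat assume ki: "k < m" "i < 2 ^ k"
      show "(\<Sum>l<2. - A (Suc (m * n + k)) (2 * (2 ^ k * j + i) + l))
        \<le> 2 * (- A (m * n + k) (2 ^ k * j + i) + E * exp ?a)"
        unfolding sum_negf using two_sided[OF desc_low[OF ki, of "m * n" j]] by (rule conjunct2)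
    qed
    then have lo: "- (\<Sum>i<2 ^ m. A (m * n + m) (2 ^ m * j + i)) \<le> 2 ^ m * (- ?a + m * (E * exp ?a))"
      by (simp add: sum_negf)
    have "\<bar>(\<Sum>i<2 ^ m. A (m * n + m) (2 ^ m * j + i)) - 2 ^ m * ?a\<bar> \<le> 2 ^ m * (m * E * exp ?a)"
      using up lo by (simp add: abs_le_iff algebra_simps)
    also have "\<dots> \<le> 2 ^ m * (K' * exp ?a)"
      using pos by (intro mult_left_mono mult_right_mono) (auto simp: K'_def)
    finally show ?case by (simp add: add.commute)
  next
    case (6 n j)
    have "(\<Sum>i<2 ^ m. A (m * n + m) (2 ^ m * j + i)) \<le> 2 ^ m * (A (m * n) j + m * (- L))"
    proof (rule binary_tree_sum_le)
      fix k i :: nat assume ki: "k < m" "i < 2 ^ k"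
      then have "A (m * n + k) (2 ^ k * j + i) \<ge> M + 2 * K"
        using near[of k i "m * n" j] 6 by (simp add: M'_def)
      from A_drift_high[OF this] show "(\<Sum>l<2. A (Suc (m * n + k)) (2 * (2 ^ k * j + i) + l))
        \<le> 2 * (A (m * n + k) (2 ^ k * j + i) + - L)"
        by simp
    qed
    also have "\<dots> \<le> 2 ^ m * (A (m * n) j - L)"
      using m0 pos by (intro mult_left_mono) auto
    finally show ?case by (simp add: add.commute)
  next
    case (7 n j)
    let ?i = "e * (2 ^ m - 1)"
    have e': "real e \<in> {0..1}" using e by auto
    have "e \<le> 1" using e by simp
    then have "?i \<le> 1 * (2 ^ m - 1)" by (rule mult_le_mono1)
    then have "?i < 2 ^ m" using zero_less_power[of "2::nat" m] by linarith
    moreover have "A (m * n + m) (2 ^ m * j + ?i) \<le> A (m * n) j - 1"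
      using w_extreme_descendant[of "m * n" m j] A_w[OF e', of "m * n" j]
        A_w[OF e', of "m * n + m" "2 ^ m * j + ?i"] mc by linarith
    ultimately show ?case by (intro exI[of _ ?i]) (simp add: add.commute)
  qed (use K' pos in auto)
  then show ?thesis by (simp only: K'_def M'_def E_def)
qed

lemma base_orbit_near_A:
  assumes "y \<in> {0..<1}"
  shows "\<bar>base_orbit f u0 (m * n) y - A (m * n) (nat \<lfloor>real (2 ^ m) ^ n * y\<rfloor>)\<bar> \<le> 2 * K"
proof -
  have "frac (2 ^ (m * n) * y) \<in> {0..1}" by (simp add: frac_ge_0 less_imp_le[OF frac_lt_1])
  from A_w[OF this, of "m * n" "nat \<lfloor>2 ^ (m * n) * y\<rfloor>"] show ?thesis
    by (simp add: base_orbit_eq_dyadic_branch[OF assms] power_mult abs_minus_commute)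
qed

lemma base_orbit_step:
  assumes "y \<in> {0..<1}"
  shows "\<bar>base_orbit f u0 (n + k) y - base_orbit f u0 n y\<bar> \<le> K * k"
proof (induction k)
  case (Suc k)
  have "(E2 ^^ (n + k)) y \<in> {0..1}"
    by (simp add: E2_funpow[OF assms] frac_ge_0 less_imp_le[OF frac_lt_1])
  from f_step[OF this, of "base_orbit f u0 (n + k) y"] Suc show ?case by (simp add: algebra_simps)
qed simp

lemma AE_infinite_base_orbit_ge:
  fixes m :: nat
  assumes mc: "m * c > 4 * K + 1"
  defines "K' \<equiv> 3 * K * m + m * (K * exp (2 * K + 3 * K * m))"
  defines "R \<equiv> 1 + K' + real (32 * 2 ^ m) * K'"
  shows "AE y in lborel. y \<in> {0..<1} \<longrightarrow> infinite {i. base_orbit f u0 i y \<ge> - (R + 2 * K)}"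
proof -
  have m: "m > 0" using mc pos by (cases m) auto
  have "AE y in lborel. y \<in> {0..<1} \<longrightarrow> infinite {n. A (m * n) (nat \<lfloor>real (2 ^ m) ^ n * y\<rfloor>) \<ge> - R}"
    unfolding R_def K'_def by (rule tree_walk.AE_infinitely_often[OF tree_walk_A[OF mc]])
  then show ?thesis
  proof (rule AE_mp, intro AE_I2 impI)
    fix y :: real
    let ?S = "{n. A (m * n) (nat \<lfloor>real (2 ^ m) ^ n * y\<rfloor>) \<ge> - R}"
    assume "y \<in> {0..<1} \<longrightarrow> infinite ?S" and y: "y \<in> {0..<1}"
    then have "infinite ((*) m ` ?S)" using m by (subst finite_image_iff) (auto simp: inj_on_def)
    moreover have "(*) m ` ?S \<subseteq> {i. base_orbit f u0 i y \<ge> - (R + 2 * K)}"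
    proof (rule image_subsetI, rule CollectI)
      fix n assume "n \<in> ?S"
      then show "base_orbit f u0 (m * n) y \<ge> - (R + 2 * K)"
        using base_orbit_near_A[OF y, of m n] by simp
    qed
    ultimately show "infinite {i. base_orbit f u0 i y \<ge> - (R + 2 * K)}"
      using infinite_super by blast
  qed
qed

text \<open>If the orbit is above -R at some time of a block, then A is above -R' at the start of
  the block: R' adds 2 K for the oscillation and K m for the travel within the block. The frequency
  over all times is thus controlled by that over blocks.\<close>

lemma AE_base_orbit_frequency_tendsto_0:
  "AE y in lborel. y \<in> {0..<1} \<longrightarrow>
    (\<lambda>n. (\<Sum>i<n. of_bool (base_orbit f u0 i y \<ge> - R)) / n) \<longlonglongrightarrow> (0::real)"
proof -
  obtain m :: nat where "real m > (4 * K + 1) / c" using reals_Archimedean2 by blast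
  then have mc: "m * c > 4 * K + 1" using pos by (simp add: field_simps)
  have m: "m > 0" using mc pos by (cases m) auto
  define R' where "R' = R + 2 * K + K * m"
  from tree_walk.AE_frequency_tendsto_0[OF tree_walk_A[OF mc], of R'] show ?thesis
  proof (rule AE_mp, intro AE_I2 impI)
    fix y :: real
    define s where "s N = (\<Sum>k<N. of_bool (A (m * k) (nat \<lfloor>real (2 ^ m) ^ k * y\<rfloor>) \<ge> - R') :: real)" for N
    assume "y \<in> {0..<1} \<longrightarrow>
      (\<lambda>n. (\<Sum>k<n. of_bool (A (m * k) (nat \<lfloor>real (2 ^ m) ^ k * y\<rfloor>) \<ge> - R')) / n) \<longlonglongrightarrow> (0::real)"
      and y: "y \<in> {0..<1}"
    then have lim: "(\<lambda>n. s n / n) \<longlonglongrightarrow> 0" by (simp add: s_def)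
    let ?b = "\<lambda>i. of_bool (base_orbit f u0 i y \<ge> - R) :: real"
    have block: "?b (k * m + i) \<le> of_bool (A (m * k) (nat \<lfloor>real (2 ^ m) ^ k * y\<rfloor>) \<ge> - R')" if "i < m" for k i
    proof -
      have "K * i \<le> K * m" using that pos by simp
      then have "A (m * k) (nat \<lfloor>real (2 ^ m) ^ k * y\<rfloor>) \<ge> - R'" if "base_orbit f u0 (k * m + i) y \<ge> - R"
        using that base_orbit_near_A[OF y, of m k] base_orbit_step[OF y, of "m * k" i]
        unfolding R'_def mult.commute[of k m] by linarith
      then show ?thesis by simp
    qed
    have bound: "(\<Sum>i<n. ?b i) / n \<le> 2 * (s (n div m + 1) / real (n div m + 1))" if n: "n \<ge> m" for n
    proof -
      \<comment> \<open>q blocks cover the first n times, and for n \<ge> m they contain at most 2 n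
        times; hence the factor 2.\<close>
      define q where "q = n div m + 1"
      have nq: "n \<le> q * m" using m by (simp add: q_def) (metis dividend_less_div_times less_imp_le)
      have qn: "q * m \<le> 2 * n" using n div_times_less_eq_dividend[of n m] unfolding q_def add_mult_distrib by linarith
      have "(\<Sum>i<n. ?b i) \<le> (\<Sum>i<q * m. ?b i)" using nq by (intro sum_mono2) auto
      also have "\<dots> = (\<Sum>k<q. sum ?b {k * m..<k * m + m})" by (rule sum.nat_group[symmetric])
      also have "\<dots> = (\<Sum>k<q. \<Sum>i<m. ?b (k * m + i))"
      proof (rule sum.cong[OF refl])
        fix k
        show "sum ?b {k * m..<k * m + m} = (\<Sum>i<m. ?b (k * m + i))"
          using sum.shift_bounds_nat_ivl[of ?b 0 "k * m" m] by (simp add: atLeast0LessThan add.commute)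
      qed
      also have "\<dots> \<le> (\<Sum>k<q. \<Sum>i<m. of_bool (A (m * k) (nat \<lfloor>real (2 ^ m) ^ k * y\<rfloor>) \<ge> - R'))"
        by (intro sum_mono block) simp
      also have "\<dots> = m * s q" by (simp add: s_def sum_distrib_left)
      finally have "(\<Sum>i<n. ?b i) / n \<le> m * s q / n" by (intro divide_right_mono) auto
      also have "\<dots> \<le> 2 * (s q / q)"
      proof -
        have "real q * m \<le> 2 * n" using qn by (metis of_nat_le_iff of_nat_mult of_nat_numeral)
        moreover have "s q \<ge> 0" unfolding s_def by (intro sum_nonneg) auto
        ultimately have "s q * (real q * m) \<le> s q * (2 * n)" by (intro mult_left_mono) auto
        moreover have "q > 0" "n > 0" using m n by (auto simp: q_def)
        ultimately show ?thesis by (simp add: field_simps)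
      qed
      finally show ?thesis by (simp add: q_def)
    qed
    have "filterlim (\<lambda>n. n div m + 1) sequentially sequentially"
    proof (rule filterlim_at_top[THEN iffD2], rule allI)
      fix N :: nat
      show "\<forall>\<^sub>F n in sequentially. N \<le> n div m + 1"
      proof (rule eventually_sequentiallyI)
        fix n assume "N * m \<le> n"
        then have "N \<le> n div m" using m by (simp add: less_eq_div_iff_mult_less_eq)
        then show "N \<le> n div m + 1" by simp
      qed
    qed
    from filterlim_compose[OF lim this]
    have "(\<lambda>n. 2 * (s (n div m + 1) / real (n div m + 1))) \<longlonglongrightarrow> 0"
      by (intro tendsto_mult_right_zero)
    then show "(\<lambda>n. (\<Sum>i<n. ?b i) / n) \<longlonglongrightarrow> 0"
    proof (rule real_tendsto_sandwich[rotated -1])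
      show "\<forall>\<^sub>F n in sequentially. (\<Sum>i<n. ?b i) / n \<le> 2 * (s (n div m + 1) / real (n div m + 1))"
        using bound by (intro eventually_sequentiallyI[of m])
      show "\<forall>\<^sub>F n in sequentially. 0 \<le> (\<Sum>i<n. ?b i) / n"
        by (intro always_eventually allI divide_nonneg_nonneg sum_nonneg) auto
    qed auto
  qed
qed

end

text \<open>R is fixed before u0: the theorem needs one threshold for \<epsilon> that serves all
  starting points x.\<close>

lemma uniform_AE_infinite_base_orbit_ge:
  "\<exists>R. \<forall>u0. AE y in lborel. y \<in> {0..<1} \<longrightarrow> infinite {i. base_orbit f u0 i y \<ge> - R}"
proof -
  obtain m :: nat where "real m > (4 * K + 1) / c" using reals_Archimedean2 by blast
  then have "m * c > 4 * K + 1" using pos by (simp add: field_simps)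
  from AE_infinite_base_orbit_ge[OF this] show ?thesis by blast
qed

end

section \<open>Logit coordinates\<close>

definition logit :: "real \<Rightarrow> real" where
  "logit x = ln x - ln (1 - x)"

definition logistic :: "real \<Rightarrow> real" where
  "logistic u = 1 / (1 + exp (- u))"

lemma logistic_pos: "0 < logistic u" and logistic_less_1: "logistic u < 1"
  by (simp_all add: logistic_def add_pos_pos)

lemma one_minus_logistic: "1 - logistic u = logistic (- u)"
proof -
  have "1 + exp u > 0" "1 + exp (- u) > 0" by (simp_all add: add_pos_pos)
  then show ?thesis by (simp add: logistic_def exp_minus field_simps)
qed

lemma logistic_le_exp: "logistic u \<le> exp u"
proof -
  have "1 / (1 + exp (- u)) \<le> 1 / exp (- u)" by (intro divide_left_mono mult_pos_pos add_pos_pos) auto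
  then show ?thesis by (simp add: logistic_def exp_minus divide_inverse)
qed

lemma logistic_le_iff: "logistic u \<le> logistic v \<longleftrightarrow> u \<le> v"
proof -
  have "1 + exp (- u) > 0" "1 + exp (- v) > 0" by (simp_all add: add_pos_pos)
  then show ?thesis by (simp add: logistic_def field_simps)
qed

lemma logit_logistic: "logit (logistic u) = u"
proof -
  have "1 + exp (- u) > 0" by (simp add: add_pos_pos)
  moreover have "1 - logistic u = exp (- u) / (1 + exp (- u))"
    using calculation by (simp add: logistic_def field_simps)
  ultimately show ?thesis by (simp add: logit_def logistic_def ln_div)
qed

lemma logistic_logit:
  assumes "0 < x" "x < 1"
  shows "logistic (logit x) = x"
  using assms by (simp add: logistic_def logit_def exp_diff exp_minus field_simps)

lemma has_real_derivative_logit: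
  assumes "0 < x" "x < 1"
  shows "(logit has_real_derivative 1 / (x * (1 - x))) (at x)"
  unfolding logit_def[abs_def] using assms
  by (auto intro!: derivative_eq_intros simp: field_simps)

lemma abs_ln_diff_le:
  fixes a b c :: real
  assumes "c > 0" "a \<ge> c" "b \<ge> c"
  shows "\<bar>ln a - ln b\<bar> \<le> \<bar>a - b\<bar> / c"
proof -
  have "ln a - ln b \<le> (a - b) / b" "ln b - ln a \<le> (b - a) / a"
    using assms by (intro ln_diff_le; simp)+
  moreover have "(a - b) / b \<le> \<bar>a - b\<bar> / c" "(b - a) / a \<le> \<bar>a - b\<bar> / c"
    using assms by (intro frac_le; simp)+
  ultimately show ?thesis by linarith
qed

lemma abs_ln_one_plus_le:
  fixes s :: real
  assumes "\<bar>s\<bar> \<le> 1 / 2"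
  shows "\<bar>ln (1 + s)\<bar> \<le> 2 * \<bar>s\<bar>"
  using abs_ln_diff_le[of "1 / 2" "1 + s" 1] assms by (simp add: abs_le_iff mult.commute)

section \<open>The unperturbed fiber maps, translations in the logit coordinate\<close>

definition mob :: "real \<Rightarrow> real \<Rightarrow> real" where
  "mob s x = exp s * x / (1 + (exp s - 1) * x)"

context
  fixes s X x :: real
  assumes s: "\<bar>s\<bar> \<le> X" and x: "x \<in> {0..1}"
begin

lemma mob_denominator:
  "1 + (exp s - 1) * x > 0" "exp (- X) * (1 + (exp s - 1) * x) \<le> exp s"
  "exp (- X) * (1 + (exp s - 1) * x) \<le> 1"
proof -
  have d: "1 + (exp s - 1) * x = (1 - x) + exp s * x" by (simp add: algebra_simps)
  have "x = 1 \<or> 1 - x > 0" using x by auto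
  then show "1 + (exp s - 1) * x > 0" unfolding d using x by (auto intro: add_pos_nonneg)
  have e: "exp (- X) \<le> 1" "exp (- X) \<le> exp s" "exp (- X) * exp s \<le> 1"
    using s by (auto simp flip: exp_add)
  have "exp (- X) * (1 - x) \<le> exp s * (1 - x)" "exp (- X) * (exp s * x) \<le> 1 * (exp s * x)"
    using e x by (intro mult_right_mono; simp)+
  then show "exp (- X) * (1 + (exp s - 1) * x) \<le> exp s"
    unfolding d by (simp add: algebra_simps)
  have "exp (- X) * (1 - x) \<le> 1 * (1 - x)" "exp (- X) * exp s * x \<le> 1 * x"
    using e x by (intro mult_right_mono; simp)+
  then show "exp (- X) * (1 + (exp s - 1) * x) \<le> 1"
    unfolding d by (simp add: algebra_simps)
qed

lemma one_minus_mob: "1 - mob s x = (1 - x) / (1 + (exp s - 1) * x)"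
  using mob_denominator(1) by (simp add: mob_def field_simps)

lemma mob_ge: "mob s x \<ge> exp (- X) * x"
proof -
  have "exp (- X) \<le> exp s / (1 + (exp s - 1) * x)"
    using mob_denominator by (simp add: le_divide_eq)
  then have "exp (- X) * x \<le> exp s / (1 + (exp s - 1) * x) * x"
    using x by (intro mult_right_mono) auto
  then show ?thesis by (simp add: mob_def)
qed

lemma one_minus_mob_ge: "1 - mob s x \<ge> exp (- X) * (1 - x)"
proof -
  have "exp (- X) \<le> 1 / (1 + (exp s - 1) * x)"
    using mob_denominator by (simp add: le_divide_eq)
  then have "exp (- X) * (1 - x) \<le> 1 / (1 + (exp s - 1) * x) * (1 - x)"
    using x by (intro mult_right_mono) auto
  then show ?thesis by (simp add: one_minus_mob)
qed

lemma has_real_derivative_mob: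
  "(mob s has_real_derivative exp s / (1 + (exp s - 1) * x)\<^sup>2) (at x within A)"
  unfolding mob_def[abs_def] using mob_denominator(1)
  by (auto intro!: derivative_eq_intros simp: power2_eq_square) (simp add: field_simps)

text \<open>The differentiated form of \<open>logit_mob\<close>: a translation has derivative 1 in
  the coordinate whose differential is dx / (x (1 - x)).\<close>

lemma mob_deriv_eq: "exp s / (1 + (exp s - 1) * x)\<^sup>2 * (x * (1 - x)) = mob s x * (1 - mob s x)"
  unfolding one_minus_mob by (simp add: mob_def power2_eq_square)

lemma logit_mob:
  assumes "0 < x" "x < 1"
  shows "logit (mob s x) = s + logit x"
  using assms mob_denominator(1) unfolding logit_def one_minus_mob
  by (simp add: mob_def ln_div ln_mult)

end

section \<open>Partial derivatives of smooth functions on the square\<close>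

lemma has_real_derivative_partials:
  fixes F :: "real \<times> real \<Rightarrow> real"
  assumes F: "(F has_derivative F') (at (y, x) within {0..1} \<times> {0..1})"
    and yx: "y \<in> {0..1}" "x \<in> {0..1}"
  shows "((\<lambda>t. F (t, x)) has_real_derivative F' (1, 0)) (at y within {0..1})"
    and "((\<lambda>t. F (y, t)) has_real_derivative F' (0, 1)) (at x within {0..1})"
proof -
  have lin: "F' (h * a, h * b) = h * F' (a, b)" for h a b
    using linear_scale[OF has_derivative_linear[OF F], of h "(a, b)"] by simp
  have "((\<lambda>t. F (t, x)) has_derivative (\<lambda>h. F' (h, 0))) (at y within {0..1})"
  proof (rule has_derivative_in_compose[where f = "\<lambda>t. (t, x)" and f' = "\<lambda>h. (h, 0)" and g' = F'])
    show "((\<lambda>t. (t, x)) has_derivative (\<lambda>h. (h, 0))) (at y within {0..1})"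
      by (intro has_derivative_Pair has_derivative_const has_derivative_ident)
    show "(F has_derivative F') (at (y, x) within (\<lambda>t. (t, x)) ` {0..1})"
      by (rule has_derivative_subset[OF F]) (use yx in auto)
  qed
  moreover have "(\<lambda>h. F' (h, 0)) = (*) (F' (1, 0))"
  proof
    fix h show "F' (h, 0) = F' (1, 0) * h" using lin[of h 1 0] by simp
  qed
  ultimately show "((\<lambda>t. F (t, x)) has_real_derivative F' (1, 0)) (at y within {0..1})"
    by (simp add: has_field_derivative_def)
  have "((\<lambda>t. F (y, t)) has_derivative (\<lambda>h. F' (0, h))) (at x within {0..1})"
  proof (rule has_derivative_in_compose[where f = "\<lambda>t. (y, t)" and f' = "\<lambda>h. (0, h)" and g' = F'])
    show "((\<lambda>t. (y, t)) has_derivative (\<lambda>h. (0, h))) (at x within {0..1})"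
      by (intro has_derivative_Pair has_derivative_const has_derivative_ident)
    show "(F has_derivative F') (at (y, x) within (\<lambda>t. (y, t)) ` {0..1})"
      by (rule has_derivative_subset[OF F]) (use yx in auto)
  qed
  moreover have "(\<lambda>h. F' (0, h)) = (*) (F' (0, 1))"
  proof
    fix h show "F' (0, h) = F' (0, 1) * h" using lin[of h 0 1] by simp
  qed
  ultimately show "((\<lambda>t. F (y, t)) has_real_derivative F' (0, 1)) (at x within {0..1})"
    by (simp add: has_field_derivative_def)
qed

text \<open>A Lipschitz bound for g itself would not survive the logit, which magnifies differences
  like 1 / x and 1 / (1 - x) at the endpoints. Integrated from an endpoint, a Lipschitz bound for
  the x-derivative yields the compensating factor x or 1 - x. It follows from the boundedness of
  continuous second derivatives on a compact square.\<close>

lemma smooth_on_square_partial_lipschitz: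
  fixes g :: "real \<Rightarrow> real \<Rightarrow> real"
  assumes "smooth_on ({0..1} \<times> {0..1}) (\<lambda>(y, x). g y x)"
  obtains gx and B :: real where "B \<ge> 0"
    "\<And>y x. y \<in> {0..1} \<Longrightarrow> x \<in> {0..1} \<Longrightarrow> (g y has_real_derivative gx y x) (at x within {0..1})"
    "\<And>y y' x x'. y \<in> {0..1} \<Longrightarrow> y' \<in> {0..1} \<Longrightarrow> x \<in> {0..1} \<Longrightarrow> x' \<in> {0..1} \<Longrightarrow>
      \<bar>gx y x - gx y' x'\<bar> \<le> B * (\<bar>y - y'\<bar> + \<bar>x - x'\<bar>)"
proof -
  let ?S = "{0..1::real} \<times> {0..1::real}"
  have "C_k_on (Suc (Suc 0)) ?S (\<lambda>(y, x). g y x)" using assms unfolding smooth_on_def by blast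
  from iffD1[OF C_k_on.simps(2) this]
  obtain F' where F0: "(\<forall>p\<in>?S. ((\<lambda>(y, x). g y x) has_derivative F' p) (at p within ?S)) \<and>
    (\<forall>v. C_k_on (Suc 0) ?S (\<lambda>p. F' p v))" ..
  then have F': "((\<lambda>(y, x). g y x) has_derivative F' p) (at p within ?S)" if "p \<in> ?S" for p
    using that by blast
  from F0 have "C_k_on (Suc 0) ?S (\<lambda>p. F' p (0, 1))" by blast
  from iffD1[OF C_k_on.simps(2) this]
  obtain F'' where F1: "(\<forall>p\<in>?S. ((\<lambda>p. F' p (0, 1)) has_derivative F'' p) (at p within ?S)) \<and>
    (\<forall>v. C_k_on 0 ?S (\<lambda>p. F'' p v))" ..
  then have F'': "((\<lambda>p. F' p (0, 1)) has_derivative F'' p) (at p within ?S)" if "p \<in> ?S" for p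
    using that by blast
  from F1 have cont: "continuous_on ?S (\<lambda>p. F'' p v)" for v
    unfolding C_k_on.simps(1) by blast
  have "\<exists>b. \<forall>p\<in>?S. norm (F'' p v) \<le> b" for v
  proof -
    have "compact ((\<lambda>p. F'' p v) ` ?S)"
      by (intro compact_continuous_image cont compact_Times) auto
    then show ?thesis using compact_imp_bounded bounded_iff by (metis imageI)
  qed
  then obtain b where b: "\<And>v p. p \<in> ?S \<Longrightarrow> norm (F'' p v) \<le> b v" by metis
  define B where "B = max 0 (max (b (1, 0)) (b (0, 1)))"
  define gx where "gx y x = F' (y, x) (0, 1)" for y x
  have 1: "\<bar>gx y x - gx y' x\<bar> \<le> B * \<bar>y - y'\<bar>" if "y \<in> {0..1}" "y' \<in> {0..1}" "x \<in> {0..1}" for y y' x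
  proof -
    have "norm (gx y x - gx y' x) \<le> B * norm (y - y')"
    proof (rule field_differentiable_bound[where S = "{0..1}" and f' = "\<lambda>t. F'' (t, x) (1, 0)"])
      fix t :: real assume t: "t \<in> {0..1}"
      show "((\<lambda>t. gx t x) has_field_derivative F'' (t, x) (1, 0)) (at t within {0..1})"
        unfolding gx_def using has_real_derivative_partials(1)[OF F''] t that by simp
      show "norm (F'' (t, x) (1, 0)) \<le> B"
        using b[of "(t, x)" "(1, 0)"] t that by (simp add: B_def)
    qed (use that in auto)
    then show ?thesis by simp
  qed
  have 2: "\<bar>gx y x - gx y x'\<bar> \<le> B * \<bar>x - x'\<bar>" if "x \<in> {0..1}" "x' \<in> {0..1}" "y \<in> {0..1}" for x x' y
  proof -
    have "norm (gx y x - gx y x') \<le> B * norm (x - x')"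
    proof (rule field_differentiable_bound[where S = "{0..1}" and f' = "\<lambda>t. F'' (y, t) (0, 1)"])
      fix t :: real assume t: "t \<in> {0..1}"
      show "((\<lambda>t. gx y t) has_field_derivative F'' (y, t) (0, 1)) (at t within {0..1})"
        unfolding gx_def using has_real_derivative_partials(2)[OF F''] t that by simp
      show "norm (F'' (y, t) (0, 1)) \<le> B"
        using b[of "(y, t)" "(0, 1)"] t that by (simp add: B_def)
    qed (use that in auto)
    then show ?thesis by simp
  qed
  show thesis
  proof (rule that[of B gx])
    fix y x :: real assume "y \<in> {0..1}" "x \<in> {0..1}"
    then show "(g y has_real_derivative gx y x) (at x within {0..1})"
      unfolding gx_def using has_real_derivative_partials(2)[OF F'] by simp
  next
    fix y y' x x' :: real
    assume *: "y \<in> {0..1}" "y' \<in> {0..1}" "x \<in> {0..1}" "x' \<in> {0..1}"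
    then show "\<bar>gx y x - gx y' x'\<bar> \<le> B * (\<bar>y - y'\<bar> + \<bar>x - x'\<bar>)"
      using 1[of y y' x] 2[of x x' y'] unfolding distrib_left by linarith
  qed (simp add: B_def)
qed

text \<open>\<open>Kg\<close> may depend on the individual map, whereas \<open>r0_small\<close>
  involves only X, because r0 is chosen before the map. The bound compares r0 with exp (-X)^2 since
  the unperturbed map m satisfies m (1 - m) \<ge> exp (-X)^2 x (1 - x).\<close>

locale perturbed_mobius =
  fixes g :: "real \<Rightarrow> real \<Rightarrow> real" and \<xi> :: "real \<Rightarrow> real" and gx rx :: "real \<Rightarrow> real \<Rightarrow> real"
    and C r0 X Kg :: real
  assumes C_pos: "C > 0" and r0_nonneg: "r0 \<ge> 0" and r0_small: "16 * r0 \<le> exp (- X) * exp (- X)"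
    and Kg_nonneg: "Kg \<ge> 0"
    and xi_le: "y \<in> {0..1} \<Longrightarrow> \<bar>\<xi> y\<bar> \<le> X"
    and g_mono: "y \<in> {0..1} \<Longrightarrow> strict_mono_on {0..1} (g y)"
    and rem_sq: "y \<in> {0..1} \<Longrightarrow> x \<in> {0..1} \<Longrightarrow> \<bar>g y x - mob (\<xi> y) x\<bar> \<le> C * x\<^sup>2"
    and rem_1: "y \<in> {0..1} \<Longrightarrow> x \<in> {0..1} \<Longrightarrow> \<bar>g y x - mob (\<xi> y) x\<bar> \<le> C * \<bar>1 - x\<bar>"
    and rem_deriv: "y \<in> {0..1} \<Longrightarrow> x \<in> {0..1} \<Longrightarrow>
      ((\<lambda>x. g y x - mob (\<xi> y) x) has_real_derivative rx y x) (at x within {0..1})"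
    and rx_le: "y \<in> {0..1} \<Longrightarrow> x \<in> {0..1} \<Longrightarrow> \<bar>rx y x\<bar> \<le> r0"
    and gx: "y \<in> {0..1} \<Longrightarrow> x \<in> {0..1} \<Longrightarrow> (g y has_real_derivative gx y x) (at x within {0..1})"
    and gx_lip: "y \<in> {0..1} \<Longrightarrow> y' \<in> {0..1} \<Longrightarrow> x \<in> {0..1} \<Longrightarrow> x' \<in> {0..1} \<Longrightarrow>
      \<bar>gx y x - gx y' x'\<bar> \<le> Kg * (\<bar>y - y'\<bar> + \<bar>x - x'\<bar>)"
begin

text \<open>A lower bound for the factor by which an unperturbed map multiplies x or 1 - x. It is
  unrelated to the parameter \<kappa> of \<open>fiber_system\<close>.\<close>

abbreviation "\<kappa> \<equiv> exp (- X)"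
abbreviation "m y x \<equiv> mob (\<xi> y) x"
abbreviation "r y x \<equiv> g y x - m y x"

lemma X_nonneg: "X \<ge> 0"
  using xi_le[of 0] by simp

lemma kappa_le_1: "\<kappa> \<le> 1"
  using X_nonneg by simp

lemma r0_le_kappa: "16 * r0 \<le> \<kappa>"
proof -
  have "\<kappa> * \<kappa> \<le> \<kappa> * 1" by (intro mult_left_mono kappa_le_1) simp
  then show ?thesis using r0_small by linarith
qed

lemma g_0: "y \<in> {0..1} \<Longrightarrow> g y 0 = 0"
  using rem_sq[of y 0] by (simp add: mob_def)

lemma g_1: "y \<in> {0..1} \<Longrightarrow> g y 1 = 1"
  using rem_1[of y 1] by (simp add: mob_def)

text \<open>The remainder vanishes at both endpoints, so the bound r0 for its derivative can be
  integrated from either of them.\<close>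

lemma r_le:
  assumes "y \<in> {0..1}" "x \<in> {0..1}"
  shows "\<bar>r y x\<bar> \<le> r0 * x" "\<bar>r y x\<bar> \<le> r0 * (1 - x)"
proof -
  have *: "norm (r y x - r y z) \<le> r0 * norm (x - z)" if "z \<in> {0..1}" for z
    by (rule field_differentiable_bound[where S = "{0..1}" and f' = "rx y"])
      (use assms that rem_deriv rx_le in auto)
  show "\<bar>r y x\<bar> \<le> r0 * x" using *[of 0] assms by (simp add: g_0 mob_def)
  show "\<bar>r y x\<bar> \<le> r0 * (1 - x)" using *[of 1] assms by (simp add: g_1 mob_def)
qed

lemma r_le_mob:
  assumes "y \<in> {0..1}" "x \<in> {0..1}"
  shows "\<bar>r y x\<bar> \<le> r0 / \<kappa> * m y x" "\<bar>r y x\<bar> \<le> r0 / \<kappa> * (1 - m y x)"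
proof -
  have "r0 / \<kappa> * (\<kappa> * x) \<le> r0 / \<kappa> * m y x" "r0 / \<kappa> * (\<kappa> * (1 - x)) \<le> r0 / \<kappa> * (1 - m y x)"
    using mob_ge[OF xi_le[OF assms(1)] assms(2)] one_minus_mob_ge[OF xi_le[OF assms(1)] assms(2)] r0_nonneg
    by (intro mult_left_mono; simp)+
  then show "\<bar>r y x\<bar> \<le> r0 / \<kappa> * m y x" "\<bar>r y x\<bar> \<le> r0 / \<kappa> * (1 - m y x)"
    using r_le[OF assms] by simp_all
qed

lemma mob_nonneg:
  assumes "y \<in> {0..1}" "x \<in> {0..1}"
  shows "m y x \<ge> 0" "1 - m y x \<ge> 0"
proof -
  have "\<kappa> * x \<ge> 0" "\<kappa> * (1 - x) \<ge> 0" using assms by auto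
  then show "m y x \<ge> 0" "1 - m y x \<ge> 0"
    using mob_ge[OF xi_le[OF assms(1)] assms(2)] one_minus_mob_ge[OF xi_le[OF assms(1)] assms(2)]
    by linarith+
qed

lemma g_ge:
  assumes "y \<in> {0..1}" "x \<in> {0..1}"
  shows "g y x \<ge> 15 / 16 * m y x" "1 - g y x \<ge> 15 / 16 * (1 - m y x)"
    "g y x \<ge> \<kappa> / 2 * x" "1 - g y x \<ge> \<kappa> / 2 * (1 - x)"
proof -
  note m = mob_nonneg[OF assms]
  have "r0 / \<kappa> \<le> 1 / 16" using r0_le_kappa by (simp add: field_simps)
  then have "r0 / \<kappa> * m y x \<le> 1 / 16 * m y x" "r0 / \<kappa> * (1 - m y x) \<le> 1 / 16 * (1 - m y x)"
    using m by (intro mult_right_mono; simp)+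
  then show 1: "g y x \<ge> 15 / 16 * m y x" "1 - g y x \<ge> 15 / 16 * (1 - m y x)"
    using r_le_mob[OF assms] unfolding abs_le_iff right_diff_distrib by linarith+
  have half: "\<kappa> / 2 * x = (\<kappa> * x) / 2" "\<kappa> / 2 * (1 - x) = (\<kappa> * (1 - x)) / 2" by simp_all
  show "g y x \<ge> \<kappa> / 2 * x" "1 - g y x \<ge> \<kappa> / 2 * (1 - x)"
    unfolding half using 1[unfolded right_diff_distrib] m mob_ge[OF xi_le[OF assms(1)] assms(2)] one_minus_mob_ge[OF xi_le[OF assms(1)] assms(2)]
    by linarith+
qed

lemma mob_bounds:
  assumes "y \<in> {0..1}" "0 < x" "x < 1"
  shows "0 < m y x" "m y x < 1"
proof -
  have "\<kappa> * x > 0" "\<kappa> * (1 - x) > 0" using assms by auto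
  then show "m y x > 0" "m y x < 1"
    using mob_ge[OF xi_le[OF assms(1)], of x] one_minus_mob_ge[OF xi_le[OF assms(1)], of x] assms(2,3)
    by (smt (verit) atLeastAtMost_iff)+
qed

lemma g_bounds:
  assumes "y \<in> {0..1}" "0 < x" "x < 1"
  shows "0 < g y x" "g y x < 1"
  using g_ge[of y x] mob_bounds[OF assms] assms by auto

lemma logit_g_diff:
  assumes y: "y \<in> {0..1}" and x: "0 < x" "x < 1"
  shows "\<bar>logit (g y x) - logit x - \<xi> y\<bar> \<le> 2 * (\<bar>r y x\<bar> / m y x + \<bar>r y x\<bar> / (1 - m y x))"
proof -
  have x': "x \<in> {0..1}" using x by auto
  note m = mob_bounds[OF assms]
  \<comment> \<open>a and b are the relative errors of g and of 1 - g. Both are at most r0 /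
    \<kappa>, and the error of the logit is ln (1 + a) - ln (1 + b).\<close>
  define a where "a = r y x / m y x"
  define b where "b = - r y x / (1 - m y x)"
  have rk: "r0 / \<kappa> \<le> 1 / 2" using r0_le_kappa r0_nonneg by (simp add: field_simps)
  have "\<bar>a\<bar> \<le> r0 / \<kappa>" "\<bar>b\<bar> \<le> r0 / \<kappa>"
    using r_le_mob[OF y x'] m by (simp_all add: a_def b_def abs_divide pos_divide_le_eq)
  then have ab: "\<bar>a\<bar> \<le> 1 / 2" "\<bar>b\<bar> \<le> 1 / 2" using rk by linarith+
  have g: "g y x = m y x * (1 + a)" "1 - g y x = (1 - m y x) * (1 + b)"
    using m by (simp_all add: a_def b_def field_simps)
  have "ln (g y x) = ln (m y x) + ln (1 + a)"
    unfolding g(1) by (rule ln_mult_pos) (use m ab in auto)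
  moreover have "ln (1 - g y x) = ln (1 - m y x) + ln (1 + b)"
    unfolding g(2) by (rule ln_mult_pos) (use m ab in auto)
  ultimately have "logit (g y x) - logit x - \<xi> y = ln (1 + a) - ln (1 + b)"
    using logit_mob[OF xi_le[OF y] x' x] by (simp add: logit_def)
  also have "\<bar>\<dots>\<bar> \<le> 2 * \<bar>a\<bar> + 2 * \<bar>b\<bar>"
    using abs_ln_one_plus_le[OF ab(1)] abs_ln_one_plus_le[OF ab(2)] by linarith
  finally show ?thesis using m by (simp add: a_def b_def abs_divide abs_minus_commute)
qed

lemma logit_g_near:
  assumes y: "y \<in> {0..1}" and x: "0 < x" "x < 1"
  shows "\<bar>logit (g y x) - logit x - \<xi> y\<bar> \<le> 4 * r0 / \<kappa>"
proof -
  have x': "x \<in> {0..1}" using x by auto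
  note m = mob_bounds[OF assms]
  have "\<bar>r y x\<bar> / m y x \<le> r0 / \<kappa>" "\<bar>r y x\<bar> / (1 - m y x) \<le> r0 / \<kappa>"
    using r_le_mob[OF y x'] m by (simp_all add: pos_divide_le_eq)
  then show ?thesis using logit_g_diff[OF assms] by (simp add: distrib_left)
qed

text \<open>For x \<le> 1 / 2 the bound C x^2 is divided by m \<ge> \<kappa> x and by 1 - m \<ge>
  \<kappa> / 2, which together with the factor 2 of \<open>logit_g_diff\<close> gives 6 C /
  \<kappa>. The summand 2 covers x > 1 / 2, where the uniform error is at most 1.\<close>

lemma logit_g_near_0:
  assumes y: "y \<in> {0..1}" and x: "0 < x" "x < 1"
  shows "\<bar>logit (g y x) - logit x - \<xi> y\<bar> \<le> (6 * C / \<kappa> + 2) * x"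
proof (cases "x \<le> 1 / 2")
  case True
  have x': "x \<in> {0..1}" using x by auto
  note m = mob_ge[OF xi_le[OF y] x'] one_minus_mob_ge[OF xi_le[OF y] x'] mob_bounds[OF assms]
  have "\<kappa> * (1 / 2) \<le> \<kappa> * (1 - x)" using True by (intro mult_left_mono) auto
  then have m1: "\<kappa> / 2 \<le> 1 - m y x" using m(2) by linarith
  have "\<bar>r y x\<bar> / m y x \<le> C * x\<^sup>2 / (\<kappa> * x)" "\<bar>r y x\<bar> / (1 - m y x) \<le> C * x\<^sup>2 / (\<kappa> / 2)"
    using rem_sq[OF y x'] m m1 x C_pos by (intro frac_le; simp)+
  moreover have "C * x\<^sup>2 / (\<kappa> * x) = C / \<kappa> * x" using x by (simp add: power2_eq_square)
  moreover have "C * x\<^sup>2 / (\<kappa> / 2) \<le> 2 * (C / \<kappa> * x)"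
  proof -
    have "x * x \<le> 1 * x" using x by (intro mult_right_mono) auto
    then have "2 * C / \<kappa> * (x * x) \<le> 2 * C / \<kappa> * x" using C_pos by (intro mult_left_mono) auto
    then show ?thesis by (simp add: power2_eq_square mult_ac)
  qed
  ultimately have "\<bar>logit (g y x) - logit x - \<xi> y\<bar> \<le> 6 * (C / \<kappa> * x)"
    using logit_g_diff[OF assms] unfolding distrib_left by linarith
  then show ?thesis using x by (simp add: distrib_right)
next
  case False
  have "4 * r0 / \<kappa> \<le> 1" using r0_le_kappa r0_nonneg by (simp add: field_simps)
  moreover have "(6 * C / \<kappa> + 2) * x \<ge> 2 * x" using x C_pos by (intro mult_right_mono) auto
  ultimately show ?thesis using logit_g_near[OF assms] False by linarith
qed

text \<open>The slope in logit coordinates is D z (1 - z) / (g (1 - g)). Without the remainder both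
  numerator and denominator equal P. The remainder raises the numerator to at most 17/16 P and
  lowers the denominator to no less than (15/16)^2 P; the quotient 272/225 is below 3/2.\<close>

lemma logit_g_lip_state:
  assumes y: "y \<in> {0..1}" and x: "0 < x" "x \<le> x'" "x' < 1"
  shows "0 \<le> logit (g y x') - logit (g y x)" "logit (g y x') - logit (g y x) \<le> 3 / 2 * (logit x' - logit x)"
proof -
  have "\<exists>D. ((\<lambda>z. 3 / 2 * logit z - logit (g y z)) has_real_derivative D) (at z) \<and> 0 \<le> D"
    if z: "x \<le> z" "z \<le> x'" for z
  proof -
    have z01: "0 < z" "z < 1" "z \<in> {0..1}" using x z by auto
    note gz = g_bounds[OF y z01(1,2)] and mz = mob_nonneg[OF y z01(3)]
    have at: "at z within {0..1} = at z" using z01 by (intro at_within_Icc_at)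
    define D where "D = exp (\<xi> y) / (1 + (exp (\<xi> y) - 1) * z)\<^sup>2 + rx y z"
    have "((\<lambda>z. m y z + r y z) has_real_derivative D) (at z)"
      unfolding D_def using rem_deriv[OF y z01(3)] has_real_derivative_mob[OF xi_le[OF y] z01(3), of UNIV]
      by (intro DERIV_add) (simp_all add: at)
    then have "(g y has_real_derivative D) (at z)" by simp
    then have "((\<lambda>z. logit (g y z)) has_real_derivative 1 / (g y z * (1 - g y z)) * D) (at z)"
      by (rule DERIV_chain2[where f = logit and g = "g y", OF has_real_derivative_logit[OF gz]])
    then have d: "((\<lambda>z. 3 / 2 * logit z - logit (g y z)) has_real_derivative
        3 / 2 * (1 / (z * (1 - z))) - 1 / (g y z * (1 - g y z)) * D) (at z)"
      by (intro DERIV_diff DERIV_cmult has_real_derivative_logit z01)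
    define P where "P = m y z * (1 - m y z)"
    have zz: "z * (1 - z) > 0" using z01 by simp
    have "D * (z * (1 - z)) = P + rx y z * (z * (1 - z))"
      using mob_deriv_eq[OF xi_le[OF y] z01(3)] by (simp add: D_def P_def distrib_right)
    also have "rx y z * (z * (1 - z)) \<le> r0 * (z * (1 - z))"
      using rx_le[OF y z01(3)] zz by (intro mult_right_mono) auto
    also have "\<dots> \<le> (\<kappa> * \<kappa> / 16) * (z * (1 - z))"
      using r0_small zz by (intro mult_right_mono) auto
    also have "\<dots> = (\<kappa> * z) * (\<kappa> * (1 - z)) / 16" by simp
    also have "(\<kappa> * z) * (\<kappa> * (1 - z)) \<le> P" unfolding P_def
      using mob_ge[OF xi_le[OF y] z01(3)] one_minus_mob_ge[OF xi_le[OF y] z01(3)] z01 mz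
      by (intro mult_mono) auto
    finally have 1: "D * (z * (1 - z)) \<le> 17 / 16 * P" by simp
    have "(15 / 16 * m y z) * (15 / 16 * (1 - m y z)) \<le> g y z * (1 - g y z)"
      using g_ge[OF y z01(3)] mz gz by (intro mult_mono) auto
    moreover have "(15 / 16 * m y z) * (15 / 16 * (1 - m y z)) = 225 / 256 * P"
      by (simp add: P_def algebra_simps)
    ultimately have "225 / 256 * P \<le> g y z * (1 - g y z)" by linarith
    moreover have "P \<ge> 0" using mz by (simp add: P_def)
    ultimately have "D * (z * (1 - z)) \<le> 3 / 2 * (g y z * (1 - g y z))" using 1 by linarith
    then have "1 / (g y z * (1 - g y z)) * D \<le> 3 / 2 * (1 / (z * (1 - z)))"
      using zz mult_pos_pos[of "g y z" "1 - g y z"] gz by (simp add: divide_le_eq le_divide_eq mult.commute)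
    then show ?thesis using d by (intro exI conjI) auto
  qed
  then have "3 / 2 * logit x - logit (g y x) \<le> 3 / 2 * logit x' - logit (g y x')"
    using DERIV_nonneg_imp_nondecreasing[of x x' "\<lambda>z. 3 / 2 * logit z - logit (g y z)"] x by simp
  then show "logit (g y x') - logit (g y x) \<le> 3 / 2 * (logit x' - logit x)" by simp
  have "g y x \<le> g y x'"
    using strict_mono_on_leD[OF g_mono[OF y], of x x'] x by simp
  then have "ln (g y x) \<le> ln (g y x')" "ln (1 - g y x') \<le> ln (1 - g y x)"
    using g_bounds[OF y, of x] g_bounds[OF y, of x'] x by auto
  then show "0 \<le> logit (g y x') - logit (g y x)" by (simp add: logit_def)
qed

lemma g_lip_base:
  assumes "y \<in> {0..1}" "y' \<in> {0..1}" "x \<in> {0..1}"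
  shows "\<bar>g y x - g y' x\<bar> \<le> Kg * \<bar>y - y'\<bar> * x" "\<bar>g y x - g y' x\<bar> \<le> Kg * \<bar>y - y'\<bar> * (1 - x)"
proof -
  have *: "norm ((g y x - g y' x) - (g y z - g y' z)) \<le> Kg * \<bar>y - y'\<bar> * norm (x - z)" if "z \<in> {0..1}" for z
  proof (rule field_differentiable_bound[where S = "{0..1}" and f' = "\<lambda>x. gx y x - gx y' x"])
    fix t :: real assume t: "t \<in> {0..1}"
    show "((\<lambda>x. g y x - g y' x) has_field_derivative gx y t - gx y' t) (at t within {0..1})"
      using assms t by (intro DERIV_diff gx)
    show "norm (gx y t - gx y' t) \<le> Kg * \<bar>y - y'\<bar>"
      using gx_lip[of y y' t t] assms t by simp
  qed (use assms that in auto)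
  show "\<bar>g y x - g y' x\<bar> \<le> Kg * \<bar>y - y'\<bar> * x" using *[of 0] assms by (simp add: g_0)
  show "\<bar>g y x - g y' x\<bar> \<le> Kg * \<bar>y - y'\<bar> * (1 - x)" using *[of 1] assms by (simp add: g_1)
qed

lemma logit_g_lip_base:
  assumes y: "y \<in> {0..1}" "y' \<in> {0..1}" and x: "0 < x" "x < 1"
  shows "\<bar>logit (g y x) - logit (g y' x)\<bar> \<le> 4 * Kg / \<kappa> * \<bar>y - y'\<bar>"
proof -
  have x': "x \<in> {0..1}" using x by auto
  have "\<bar>ln (g y x) - ln (g y' x)\<bar> \<le> \<bar>g y x - g y' x\<bar> / (\<kappa> / 2 * x)"
    using g_ge[OF y(1) x'] g_ge[OF y(2) x'] x by (intro abs_ln_diff_le) auto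
  also have "\<dots> \<le> Kg * \<bar>y - y'\<bar> * x / (\<kappa> / 2 * x)"
    using g_lip_base(1)[OF y x'] x by (intro divide_right_mono) auto
  also have "\<dots> = 2 * Kg / \<kappa> * \<bar>y - y'\<bar>" using x by simp
  finally have 1: "\<bar>ln (g y x) - ln (g y' x)\<bar> \<le> 2 * Kg / \<kappa> * \<bar>y - y'\<bar>" .
  have "\<bar>ln (1 - g y x) - ln (1 - g y' x)\<bar> \<le> \<bar>(1 - g y x) - (1 - g y' x)\<bar> / (\<kappa> / 2 * (1 - x))"
    using g_ge[OF y(1) x'] g_ge[OF y(2) x'] x by (intro abs_ln_diff_le) auto
  also have "\<dots> \<le> Kg * \<bar>y - y'\<bar> * (1 - x) / (\<kappa> / 2 * (1 - x))"
    using g_lip_base(2)[OF y x'] x by (intro divide_right_mono) auto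
  also have "\<dots> = 2 * Kg / \<kappa> * \<bar>y - y'\<bar>" using x by simp
  finally have 2: "\<bar>ln (1 - g y x) - ln (1 - g y' x)\<bar> \<le> 2 * Kg / \<kappa> * \<bar>y - y'\<bar>" .
  have "4 * Kg / \<kappa> * \<bar>y - y'\<bar> = 2 * Kg / \<kappa> * \<bar>y - y'\<bar> + 2 * Kg / \<kappa> * \<bar>y - y'\<bar>" by simp
  then show ?thesis using 1 2 unfolding logit_def by linarith
qed

lemma chord_slope:
  assumes y: "y \<in> {0..1}" and x: "0 < x" "x < 1"
  shows "(1 - g y x) / (1 - x) \<ge> \<kappa> / 2" "\<bar>(1 - g y x) / (1 - x) - gx y 1\<bar> \<le> Kg * (1 - x)"
proof -
  show "(1 - g y x) / (1 - x) \<ge> \<kappa> / 2" using g_ge(4)[OF y, of x] x by (simp add: pos_le_divide_eq)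
  have "\<exists>z\<in>{x<..<1}. g y 1 - g y x = (*) (gx y z) (1 - x)"
  proof (rule mvt_simple)
    fix z assume z: "x \<le> z" "z \<le> 1"
    then have "(g y has_real_derivative gx y z) (at z within {x..1})"
      using x y by (intro DERIV_subset[OF gx]) auto
    then show "(g y has_derivative (*) (gx y z)) (at z within {x..1})"
      by (simp add: has_field_derivative_def)
  qed (use x in simp)
  then obtain z where z: "x < z" "z < 1" "1 - g y x = gx y z * (1 - x)" using g_1[OF y] by auto
  have "\<bar>gx y z - gx y 1\<bar> \<le> Kg * \<bar>z - 1\<bar>" using gx_lip[of y y z 1] y z x by simp
  also have "\<dots> \<le> Kg * (1 - x)" using z Kg_nonneg by (intro mult_left_mono) auto
  finally show "\<bar>(1 - g y x) / (1 - x) - gx y 1\<bar> \<le> Kg * (1 - x)" using z x by simp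
qed

lemma gx_1_ge: "y \<in> {0..1} \<Longrightarrow> gx y 1 \<ge> \<kappa> / 2"
proof (rule field_le_epsilon)
  fix d :: real assume y: "y \<in> {0..1}" and d: "d > 0"
  define x where "x = 1 - min (1 / 2) (d / (Kg + 1))"
  have x: "0 < x" "x < 1" using d Kg_nonneg by (auto simp: x_def)
  have "Kg * (1 - x) \<le> Kg * (d / (Kg + 1))" using Kg_nonneg by (intro mult_left_mono) (auto simp: x_def)
  also have "\<dots> \<le> d" using Kg_nonneg d by (simp add: field_simps)
  finally show "\<kappa> / 2 \<le> gx y 1 + d" using chord_slope[OF y x] by linarith
qed

text \<open>With the chord slope a, 1 - g = a (1 - x), so logit g = ln g - ln a - ln (1 - x) \<le>
  logit x - ln x - ln a. Both -ln x and the distance of ln a from the logarithm of the derivative at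
  1 are O(1 - x).\<close>

lemma logit_g_high:
  assumes y: "y \<in> {0..1}" and x: "1 / 2 \<le> x" "x < 1"
  shows "logit (g y x) \<le> logit x - ln (gx y 1) + (2 + 2 * Kg / \<kappa>) * (1 - x)"
proof -
  have x0: "0 < x" using x by simp
  define a where "a = (1 - g y x) / (1 - x)"
  note cs = chord_slope[OF y x0 x(2), folded a_def]
  have a0: "a > 0" using cs(1) exp_gt_zero[of "- X"] by linarith
  have "1 - g y x = a * (1 - x)" using x by (simp add: a_def)
  then have "ln (1 - g y x) = ln a + ln (1 - x)" using a0 x by (simp add: ln_mult_pos)
  moreover have "ln (g y x) \<le> 0" using g_bounds[OF y x0 x(2)] by simp
  moreover have "- ln x \<le> 2 * (1 - x)"
  proof -
    have "ln 1 - ln x \<le> (1 - x) / x" using x0 by (intro ln_diff_le) auto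
    also have "\<dots> \<le> (1 - x) / (1 / 2)" using x by (intro divide_left_mono) auto
    finally show ?thesis by simp
  qed
  moreover have "\<bar>ln a - ln (gx y 1)\<bar> \<le> 2 * Kg / \<kappa> * (1 - x)"
  proof -
    have "\<bar>ln a - ln (gx y 1)\<bar> \<le> \<bar>a - gx y 1\<bar> / (\<kappa> / 2)"
      using cs(1) gx_1_ge[OF y] by (intro abs_ln_diff_le) auto
    also have "\<dots> \<le> Kg * (1 - x) / (\<kappa> / 2)" using cs(2) by (intro divide_right_mono) auto
    finally show ?thesis by (simp add: mult_ac)
  qed
  ultimately show ?thesis unfolding logit_def distrib_right by linarith
qed

definition f :: "real \<Rightarrow> real \<Rightarrow> real" where
  "f t u = logit (g t (logistic u))"

text \<open>Half of \<Lambda> is given up to absorb the error of \<open>logit_g_high\<close>, by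
  taking M so large that H e^(-M) \<le> \<Lambda> / 2. Half of -\<xi> (e) is given up to absorb the
  error 4 r0 / \<kappa>. K is a sum so that it dominates the constants of all the bounds at
  once.\<close>

lemma fiber_system_f:
  assumes xi: "(\<xi> has_integral 0) {0..1}"
    and \<Lambda>: "((\<lambda>t. ln (gx t 1)) has_integral \<Lambda>) {0..1}" "\<Lambda> > 0"
    and e: "e < 2" "8 * r0 < \<kappa> * (- \<xi> (real e))"
  shows "\<exists>K M. fiber_system f \<xi> (\<lambda>t. ln (gx t 1) - \<Lambda> / 2) K M (\<Lambda> / 2) (- \<xi> (real e) / 2) e"
proof -
  define K where "K = (X + 1) + 4 * Kg / \<kappa> + (6 * C / \<kappa> + 2)"
  have nn: "X \<ge> 0" "4 * Kg / \<kappa> \<ge> 0" "6 * C / \<kappa> \<ge> 0" using X_nonneg Kg_nonneg C_pos by auto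
  have r0k: "4 * r0 / \<kappa> \<le> 1" using r0_le_kappa r0_nonneg by (simp add: field_simps)
  define H where "H = 2 + 2 * Kg / \<kappa>"
  have H: "H > 0" using Kg_nonneg by (simp add: H_def add_pos_nonneg)
  define M where "M = max 0 (ln (H / (\<Lambda> / 2)))"
  have HM: "H * exp (- M) \<le> \<Lambda> / 2"
  proof -
    have "H / (\<Lambda> / 2) = exp (ln (H / (\<Lambda> / 2)))" using H \<Lambda> by (intro exp_ln[symmetric]) simp
    also have "\<dots> \<le> exp M" by (simp add: M_def)
    finally show ?thesis using \<Lambda>(2) by (simp add: exp_minus field_simps)
  qed
  note lo = logistic_pos logistic_less_1
  have er: "real e \<in> {0..1}" using e(1) by auto
  have near: "\<bar>f t u - u - \<xi> t\<bar> \<le> 4 * r0 / \<kappa>" if "t \<in> {0..1}" for t u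
    using logit_g_near[OF that lo, of u] by (simp add: f_def logit_logistic)
  have "0 \<le> 8 * r0" using r0_nonneg by simp
  then have xe: "- \<xi> (real e) > 0" using e(2) by (smt (verit) exp_gt_zero zero_less_mult_pos)
  have lip: "\<bar>f t u - f t v\<bar> \<le> 3 / 2 * \<bar>u - v\<bar>" if "t \<in> {0..1}" "u \<le> v" for t u v
    using logit_g_lip_state[OF that(1) logistic_pos[of u] _ logistic_less_1[of v]] that(2)
    by (simp add: f_def logistic_le_iff logit_logistic)
  have "fiber_system f \<xi> (\<lambda>t. ln (gx t 1) - \<Lambda> / 2) K M (\<Lambda> / 2) (- \<xi> (real e) / 2) e"
  proof (unfold_locales, goal_cases)
    case 1
    show ?case using nn by (simp add: K_def)
  next
    case 2
    show ?case using \<Lambda> by simp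
  next
    case 3
    show ?case using xe by simp
  next
    case 4
    show ?case by (rule e)
  next
    case (5 t u v)
    then show ?case using lip[of t u v] lip[of t v u] by (cases "u \<le> v") (auto simp: abs_minus_commute)
  next
    case (6 s t u)
    have "4 * Kg / \<kappa> * \<bar>s - t\<bar> \<le> K * \<bar>s - t\<bar>" using nn by (intro mult_right_mono) (auto simp: K_def)
    then show ?case using logit_g_lip_base[OF 6 lo, of u] by (simp add: f_def)
  next
    case (7 t u)
    then show ?case using near[OF 7, of u] xi_le[OF 7] r0k nn unfolding K_def by linarith
  next
    case (8 t u)
    have "(6 * C / \<kappa> + 2) * logistic u \<le> K * exp u"
      using nn logistic_le_exp[of u] less_imp_le[OF logistic_pos[of u]]
      by (intro mult_mono) (auto simp: K_def)
    then show ?case using logit_g_near_0[OF 8 lo, of u] by (simp add: f_def logit_logistic)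
  next
    case (9 t u)
    have "logistic 0 \<le> logistic u" using 9 by (simp add: logistic_le_iff M_def)
    then have half: "1 / 2 \<le> logistic u" by (simp add: logistic_def)
    have "1 - logistic u \<le> exp (- M)"
      using 9 logistic_le_exp[of "- u"] unfolding one_minus_logistic by (smt (verit) exp_le_cancel_iff)
    then have "H * (1 - logistic u) \<le> H * exp (- M)" using H by (intro mult_left_mono) auto
    then show ?case
      using logit_g_high[OF 9(1) half logistic_less_1] HM by (simp add: f_def logit_logistic H_def)
  next
    case 10
    show ?case by (rule xi)
  next
    case 11
    show ?case using has_integral_diff[OF \<Lambda>(1) has_integral_const_real[of "\<Lambda> / 2" 0 1]] by simp
  next
    case (12 u)
    have "4 * r0 / \<kappa> \<le> - \<xi> (real e) / 2" using e(2) by (simp add: field_simps)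
    then show ?case using near[OF er, of u] by linarith
  qed
  then show ?thesis by blast
qed

end

section \<open>An endpoint with negative \<xi>, and the theorem\<close>

lemma strict_mono_integral_0_imp_neg:
  fixes \<xi> :: "real \<Rightarrow> real"
  assumes "continuous_on {0..1} \<xi>" "strict_mono_on {0..1} \<xi>" "integral {0..1} \<xi> = 0"
  shows "\<xi> 0 < 0"
proof (rule ccontr)
  assume "\<not> \<xi> 0 < 0"
  then have nn: "\<xi> x \<ge> 0" if "x \<in> {0..1}" for x
    using strict_mono_on_leD[OF assms(2), of 0 x] that by simp
  then have "\<forall>x\<in>{0..1}. \<xi> x = 0"
    using integral_eq_0_iff[OF assms(1)] assms(3) by auto
  then have "\<xi> 0 = \<xi> 1" by simp
  then show False using strict_mono_onD[OF assms(2), of 0 1] by simp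
qed

lemma strict_monotone_integral_0_imp_neg_endpoint:
  fixes \<xi> :: "real \<Rightarrow> real"
  assumes cont: "continuous_on {0..1} \<xi>" and "strict_mono_on {0..1} \<xi> \<or> strict_antimono_on {0..1} \<xi>"
    and int: "integral {0..1} \<xi> = 0"
  obtains e :: nat where "e < 2" "\<xi> (real e) < 0"
  using assms(2)
proof
  assume "strict_mono_on {0..1} \<xi>"
  from strict_mono_integral_0_imp_neg[OF cont this int] show thesis by (intro that[of 0]) auto
next
  assume anti: "strict_antimono_on {0..1} \<xi>"
  have "\<xi> 1 < 0"
  proof (rule ccontr)
    assume "\<not> \<xi> 1 < 0"
    then have "\<xi> 1 \<ge> 0" by simp
    have less: "\<xi> y < \<xi> x" if "x < y" "x \<in> {0..1}" "y \<in> {0..1}" for x y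
      using anti that by (auto simp: monotone_on_def)
    have "\<xi> x \<ge> 0" if "x \<in> {0..1}" for x
    proof (cases "x = 1")
      case False
      then show ?thesis using less[of x 1] \<open>\<xi> 1 \<ge> 0\<close> that by simp
    qed (use \<open>\<xi> 1 \<ge> 0\<close> in simp)
    then have "\<forall>x\<in>{0..1}. \<xi> x = 0"
      using integral_eq_0_iff[OF cont] int by auto
    then have "\<xi> 0 = \<xi> 1" by simp
    then show False using less[of 0 1] by simp
  qed
  then show thesis by (intro that[of 1]) auto
qed

theorem theorem1p2:
  fixes \<xi> :: "real \<Rightarrow> real" and C :: real
  assumes "smooth_on {0..1} \<xi>"
    and "strict_mono_on {0..1} \<xi> \<or> strict_antimono_on {0..1} \<xi>"
    and "integral {0..1} \<xi> = 0"
    and "C > 0"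
  shows "\<forall>\<^sub>F r0 in at_right 0. \<forall>G\<in>skew_product_maps \<xi> C r0.
           fiber_lyapunov G 0 = 0 \<longrightarrow> fiber_lyapunov G 1 > 0 \<longrightarrow>
           (\<forall>\<^sub>F \<epsilon> in at_right 0. \<forall>x\<in>{0<..<1}.
              AE y in lebesgue_on {0..1}.
                infinite {i. fiber_iterate G i y x \<in> {\<epsilon>..1}} \<and>
                (\<lambda>n. 1 / real n * (\<Sum>i<n. indicator {\<epsilon>..1} (fiber_iterate G i y x) :: real))
                  \<longlonglongrightarrow> 0)"
proof -
  have "C_k_on 0 {0..1} \<xi>" using assms(1) unfolding smooth_on_def by blast
  then have cont: "continuous_on {0..1} \<xi>" by simp
  have xi_int: "(\<xi> has_integral 0) {0..1}"
    using integrable_integral[OF integrable_continuous_interval[OF cont]] assms(3) by simp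
  obtain X where X: "\<And>y. y \<in> {0..1} \<Longrightarrow> \<bar>\<xi> y\<bar> \<le> X"
    using compact_imp_bounded[OF compact_continuous_image[OF cont compact_Icc]]
    unfolding bounded_iff by (metis imageI real_norm_def)
  obtain e :: nat where e: "e < 2" "\<xi> (real e) < 0"
    using strict_monotone_integral_0_imp_neg_endpoint[OF cont assms(2,3)] .
  \<comment> \<open>The threshold depends on \<xi> alone. The first entry provides
    \<open>r0_small\<close>, hence the Lipschitz constant 3 / 2; the second provides the descent
    over the base point e.\<close>
  define \<rho> where "\<rho> = min (exp (- X) * exp (- X) / 16) (exp (- X) * (- \<xi> (real e)) / 8)"
  have "\<rho> > 0" using e by (simp add: \<rho>_def mult_pos_neg)
  then have "\<forall>\<^sub>F r0 in at_right 0. 0 < r0 \<and> r0 < \<rho>"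
    by (auto simp: eventually_at_right_field)
  then show ?thesis
  proof (rule eventually_mono, intro ballI impI)
    fix r0 G
    assume r0: "0 < r0 \<and> r0 < \<rho>" and G: "G \<in> skew_product_maps \<xi> C r0"
      and lyap: "fiber_lyapunov G 1 > 0"
    let ?g = "fiber_map G"
    from G have smooth: "smooth_on ({0..1} \<times> {0..1}) (\<lambda>(y, x). ?g y x)"
      and mono: "\<And>y. y \<in> {0..1} \<Longrightarrow> strict_mono_on {0..1} (?g y)"
      unfolding skew_product_maps_def by blast+
    from G obtain r where r': "\<forall>y\<in>{0..1}. \<forall>x\<in>{0..1}.
           ?g y x = exp (\<xi> y) * x / (1 + (exp (\<xi> y) - 1) * x) + r y x \<and>
           \<bar>r y x\<bar> \<le> C * x\<^sup>2 \<and> \<bar>r y x\<bar> \<le> C * \<bar>1 - x\<bar> \<and> \<bar>r y x\<bar> \<le> r0 \<and>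
           (\<exists>rx. ((\<lambda>t. r y t) has_real_derivative rx) (at x within {0..1}) \<and> \<bar>rx\<bar> \<le> r0) \<and>
           (\<exists>ry. ((\<lambda>t. r t x) has_real_derivative ry) (at y within {0..1}) \<and> \<bar>ry\<bar> \<le> r0)"
      unfolding skew_product_maps_def by blast
    have r: "?g y x = mob (\<xi> y) x + r y x" "\<bar>r y x\<bar> \<le> C * x\<^sup>2" "\<bar>r y x\<bar> \<le> C * \<bar>1 - x\<bar>"
      "\<exists>rx. (r y has_real_derivative rx) (at x within {0..1}) \<and> \<bar>rx\<bar> \<le> r0"
      if "y \<in> {0..1}" "x \<in> {0..1}" for y x
      using r'[THEN bspec, OF that(1), THEN bspec, OF that(2)] unfolding mob_def by blast+
    from r(4) obtain rx where rx: "\<And>y x. y \<in> {0..1} \<Longrightarrow> x \<in> {0..1} \<Longrightarrow>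
        (r y has_real_derivative rx y x) (at x within {0..1}) \<and> \<bar>rx y x\<bar> \<le> r0"
      by metis
    obtain gx Kg where Kg: "Kg \<ge> 0"
      and gx: "\<And>y x. y \<in> {0..1} \<Longrightarrow> x \<in> {0..1} \<Longrightarrow> (?g y has_real_derivative gx y x) (at x within {0..1})"
      and gx_lip: "\<And>y y' x x'. y \<in> {0..1} \<Longrightarrow> y' \<in> {0..1} \<Longrightarrow> x \<in> {0..1} \<Longrightarrow> x' \<in> {0..1} \<Longrightarrow>
        \<bar>gx y x - gx y' x'\<bar> \<le> Kg * (\<bar>y - y'\<bar> + \<bar>x - x'\<bar>)"
      by (rule smooth_on_square_partial_lipschitz[OF smooth]) (rule that; assumption)
    interpret perturbed_mobius ?g \<xi> gx rx C r0 X Kg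
    proof (unfold_locales, goal_cases)
      case 3
      show ?case using r0 by (simp add: \<rho>_def)
    next
      case (9 y x)
      show ?case
      \<comment> \<open>The difference of the fiber map and \<open>mob\<close> agrees with r y only
        on [0, 1], so the derivative is transferred within that interval; the radius 1 is
        arbitrary.\<close>
      proof (rule has_field_derivative_transform_within[of "r y" _ x _ 1])
        show "(r y has_real_derivative rx y x) (at x within {0..1})" using rx 9 by blast
      qed (use r(1) 9 in auto)
    qed (use assms(4) r0 Kg X mono r rx gx gx_lip in auto)
    have "continuous_on {0..1} (\<lambda>t. gx t 1)"
      by (rule lipschitz_on_continuous_on[of Kg], rule lipschitz_onI)
        (use gx_lip[of _ _ 1 1] Kg in \<open>auto simp: dist_real_def\<close>)
    moreover have gx1: "gx t 1 > 0" if "t \<in> {0..1}" for t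
      using gx_1_ge[OF that] exp_gt_zero[of "- X"] by linarith
    ultimately have "continuous_on {0..1} (\<lambda>t. ln (gx t 1))"
      by (intro continuous_on_ln) force+
    then have "((\<lambda>t. ln (gx t 1)) has_integral integral {0..1} (\<lambda>t. ln (gx t 1))) {0..1}"
      by (intro integrable_integral integrable_continuous_interval)
    moreover have "integral {0..1} (\<lambda>t. ln (gx t 1)) = fiber_lyapunov G 1"
      unfolding fiber_lyapunov_def
    proof (rule Henstock_Kurzweil_Integration.integral_cong)
      fix t :: real assume t: "t \<in> {0..1}"
      have "vector_derivative (?g t) (at 1 within {0..1}) = gx t 1"
        using vector_derivative_within_cbox[of 0 1 1 "?g t" "gx t 1"] gx[OF t, of 1]
        by (simp add: has_real_derivative_iff_has_vector_derivative)
      then show "ln (gx t 1) = ln (vector_derivative (?g t) (at 1 within {0..1}))" by simp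
    qed
    ultimately have \<Lambda>: "((\<lambda>t. ln (gx t 1)) has_integral fiber_lyapunov G 1) {0..1}" by simp
    have "8 * r0 < exp (- X) * (- \<xi> (real e))" using r0 by (simp add: \<rho>_def)
    from fiber_system_f[OF xi_int \<Lambda> lyap e(1) this]
    obtain K M where fs: "fiber_system f \<xi> (\<lambda>t. ln (gx t 1) - fiber_lyapunov G 1 / 2) K M
        (fiber_lyapunov G 1 / 2) (- \<xi> (real e) / 2) e"
      by blast
    obtain R where R: "\<And>u0. AE y in lborel. y \<in> {0..<1} \<longrightarrow> infinite {i. base_orbit f u0 i y \<ge> - R}"
      using fiber_system.uniform_AE_infinite_base_orbit_ge[OF fs] by blast
    have orbit: "fiber_iterate G i y x = logistic (base_orbit f (logit x) i y)"
      if "x \<in> {0<..<1}" "y \<in> {0..<1}" for i x y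
    proof (induction i)
      case 0
      then show ?case using that by (simp add: logistic_logit)
    next
      case (Suc i)
      have "(E2 ^^ i) y \<in> {0..1}"
        using that(2) by (simp add: E2_funpow frac_ge_0 less_imp_le[OF frac_lt_1])
      from g_bounds[OF this logistic_pos logistic_less_1] Suc
      show ?case by (simp add: f_def logistic_logit)
    qed
    \<comment> \<open>For such \<epsilon> the set {\<epsilon>..1} contains the image of all u \<ge>
      -R, so visits above -R are visits to it, for every x.\<close>
    have "\<forall>\<^sub>F \<epsilon> in at_right 0. 0 < \<epsilon> \<and> \<epsilon> < logistic (- R)"
      using logistic_pos[of "- R"] by (auto simp: eventually_at_right_field)
    then show "\<forall>\<^sub>F \<epsilon> in at_right 0. \<forall>x\<in>{0<..<1}.
              AE y in lebesgue_on {0..1}.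
                infinite {i. fiber_iterate G i y x \<in> {\<epsilon>..1}} \<and>
                (\<lambda>n. 1 / real n * (\<Sum>i<n. indicator {\<epsilon>..1} (fiber_iterate G i y x) :: real))
                  \<longlonglongrightarrow> 0"
    proof (rule eventually_mono, intro ballI)
      fix \<epsilon> x :: real
      assume \<epsilon>: "0 < \<epsilon> \<and> \<epsilon> < logistic (- R)" and x: "x \<in> {0<..<1}"
      have \<epsilon>1: "\<epsilon> < 1" using \<epsilon> logistic_less_1[of "- R"] by linarith
      have visit: "fiber_iterate G i y x \<in> {\<epsilon>..1} \<longleftrightarrow> base_orbit f (logit x) i y \<ge> - (- logit \<epsilon>)"
        if "y \<in> {0..<1}" for i y
      proof -
        have "\<epsilon> \<le> logistic u \<longleftrightarrow> logit \<epsilon> \<le> u" for u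
          using logistic_le_iff[of "logit \<epsilon>" u] \<epsilon> \<epsilon>1 by (simp add: logistic_logit)
        then show ?thesis using orbit[OF x that] less_imp_le[OF logistic_less_1] by simp
      qed
      have "logit \<epsilon> \<le> - R"
        using logistic_le_iff[of "logit \<epsilon>" "- R"] \<epsilon> \<epsilon>1 by (simp add: logistic_logit)
      then have sub: "{i. base_orbit f (logit x) i y \<ge> - R} \<subseteq> {i. base_orbit f (logit x) i y \<ge> - (- logit \<epsilon>)}" for y
        by auto
      have "AE y in lborel. y \<in> {0..<1} \<longrightarrow>
          infinite {i. fiber_iterate G i y x \<in> {\<epsilon>..1}} \<and>
          (\<lambda>n. 1 / real n * (\<Sum>i<n. indicator {\<epsilon>..1} (fiber_iterate G i y x) :: real)) \<longlonglongrightarrow> 0"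
        using R[of "logit x"] fiber_system.AE_base_orbit_frequency_tendsto_0[OF fs, of "- logit \<epsilon>" "logit x"]
      proof eventually_elim
        case (elim y)
        show ?case
        proof (intro impI conjI)
          assume y: "y \<in> {0..<1}"
          then show "infinite {i. fiber_iterate G i y x \<in> {\<epsilon>..1}}"
            unfolding visit[OF y] using elim(1) infinite_super[OF sub] by blast
          have "(\<Sum>i<n. indicator {\<epsilon>..1} (fiber_iterate G i y x))
              = (\<Sum>i<n. of_bool (base_orbit f (logit x) i y \<ge> - (- logit \<epsilon>)) :: real)" for n
            by (intro sum.cong refl) (simp only: indicator_def visit[OF y])
          then show "(\<lambda>n. 1 / real n * (\<Sum>i<n. indicator {\<epsilon>..1} (fiber_iterate G i y x) :: real)) \<longlonglongrightarrow> 0"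
            using elim(2) y by simp
        qed
      qed
      then have "AE y in lebesgue. y \<in> {0..<1} \<longrightarrow>
          infinite {i. fiber_iterate G i y x \<in> {\<epsilon>..1}} \<and>
          (\<lambda>n. 1 / real n * (\<Sum>i<n. indicator {\<epsilon>..1} (fiber_iterate G i y x) :: real)) \<longlonglongrightarrow> 0"
        by (rule AE_completion)
      \<comment> \<open>The digit description of the base orbit requires y < 1; the endpoint is a
        null set.\<close>
      moreover have "AE y in lebesgue. y \<noteq> (1::real)"
        by (rule AE_completion) (rule AE_lborel_singleton)
      ultimately have "AE y in lebesgue. y \<in> {0..1} \<longrightarrow>
          infinite {i. fiber_iterate G i y x \<in> {\<epsilon>..1}} \<and>
          (\<lambda>n. 1 / real n * (\<Sum>i<n. indicator {\<epsilon>..1} (fiber_iterate G i y x) :: real)) \<longlonglongrightarrow> 0"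
        by eventually_elim auto
      then show "AE y in lebesgue_on {0..1}.
          infinite {i. fiber_iterate G i y x \<in> {\<epsilon>..1}} \<and>
          (\<lambda>n. 1 / real n * (\<Sum>i<n. indicator {\<epsilon>..1} (fiber_iterate G i y x) :: real)) \<longlonglongrightarrow> 0"
        by (subst AE_restrict_space_iff) auto
    qed
  qed
qed

end
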